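(* Let $\lambda,\mu,\theta\in(0,\infty)$ with $\lambda\ge\mu$ and let $x_0\in\mathbb{R}_+$. With $I_T$ as defined in the context (with initial value $x_0$), let $$I^*_{\gamma,T}=\inf\{I_T(\xi,\zeta):\zeta(T)=\gamma T\}\ (\gamma\ge0),\quad I_{\gamma,T}=\inf\{I_T(\xi,\zeta):\zeta(T)\ge\gamma T\}\ (\gamma\ge\lambda-\mu),$$ $$\tilde I_{\gamma,T}=\inf\{I_T(\xi,\zeta):\zeta(T)\le\gamma T\}\ (0\le\gamma\le\lambda-\mu),$$ the infima being over $(\xi,\zeta)\in\mathcal{C}([0,T]:\mathbb{R}_+^2)$. Let $$z_\gamma=\frac{\sqrt{\gamma^2+4\lambda\mu}-\gamma}{2\mu},\qquad C(\gamma)=\lambda(1-z_\gamma^{-1})+\mu(1-z_\gamma)-\gamma\log z_\gamma .$$ Then $$\lim_{T\to\infty}\frac{I^*_{\gamma,T}}{T}=C(\gamma)\ \text{ for all }\gamma\ge0,\qquad \lim_{T\to\infty}\frac{I_{\gamma,T}}{T}=C(\gamma)\ \text{ for all }\gamma\ge\lambda-\mu,$$ $$\lim_{T\to\infty}\frac{\tilde I_{\gamma,T}}{T}=C(\gamma)\ \text{ for all }0\le\gamma\le\lambda-\mu.$$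
   Context: $\mathcal{C}([0,T]:\mathbb{R}_+^2)$ is the space of continuous functions from $[0,T]$ to $\mathbb{R}_+^2$. Let $\ell(x)=x\log x-x+1$ for $x\ge 0$ (with $\ell(0)=1$), and let $\Gamma$ be the one-dimensional Skorohod map $\Gamma(\psi)(t)=\psi(t)-\inf_{0\le s\le t}[\psi(s)\wedge 0]$. For $(\xi,\zeta)\in\mathcal{C}([0,T]:\mathbb{R}_+^2)$ let $\mathcal{U}(\xi,\zeta)$ be the collection of all $\varphi=(\varphi_1,\varphi_2,\varphi_3)$ of measurable maps $\varphi_i:[0,T]\to\mathbb{R}_+$ such that for all $t\in[0,T]$ $$\xi(t)=\Gamma\Big(x_0+\lambda\int_0^{\cdot}\varphi_1(s)ds-\mu\int_0^{\cdot}\varphi_2(s)ds-\theta\int_0^{\cdot}\varphi_3(s)\xi(s)ds\Big)(t),\qquad \zeta(t)=\theta\int_0^t\varphi_3(s)\xi(s)ds.$$ Define $$I_T(\xi,\zeta)=\inf_{\varphi\in\mathcal{U}(\xi,\zeta)}\Big\{\lambda\int_0^T\ell(\varphi_1(s))ds+\mu\int_0^T\ell(\varphi_2(s))ds+\theta\int_0^T\xi(s)\ell(\varphi_3(s))ds\Big\},$$ with $I_T(\xi,\zeta)=\infty$ if $\mathcal{U}(\xi,\zeta)=\emptyset$. *)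

theory Defs
  imports "HOL-Analysis.Analysis"
begin

text \<open>Since \<^term>\<open>ln (0::real) = 0\<close>, this gives \<open>ell 0 = 1\<close>.\<close>

definition ell :: "real \<Rightarrow> real" where
  "ell x = x * ln x - x + 1"

definition skorohod :: "(real \<Rightarrow> real) \<Rightarrow> real \<Rightarrow> real" where
  "skorohod \<psi> t = \<psi> t - (INF s\<in>{0..t}. min (\<psi> s) 0)"

text \<open>Paths are functions on all of \<open>\<real>\<close>; only their values on \<open>[0,T]\<close> are ever used.\<close>

definition paths :: "real \<Rightarrow> ((real \<Rightarrow> real) \<times> (real \<Rightarrow> real)) set" where
  "paths T = {(\<xi>, \<zeta>).
     continuous_on {0..T} \<xi> \<and> continuous_on {0..T} \<zeta> \<and>
     (\<forall>t\<in>{0..T}. 0 \<le> \<xi> t \<and> 0 \<le> \<zeta> t)}"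

text \<open>The three integrability conditions say that the integrals in the two equations are finite,
  which those equations presuppose; without them a divergent integral would silently be \<open>0\<close>.\<close>

definition controls ::
  "real \<Rightarrow> real \<Rightarrow> real \<Rightarrow> real \<Rightarrow> real \<Rightarrow> (real \<Rightarrow> real) \<Rightarrow> (real \<Rightarrow> real)
    \<Rightarrow> ((real \<Rightarrow> real) \<times> (real \<Rightarrow> real) \<times> (real \<Rightarrow> real)) set" where
  "controls lam \<mu> \<theta> x0 T \<xi> \<zeta> = {(\<phi>1, \<phi>2, \<phi>3).
     (\<forall>\<phi>\<in>{\<phi>1, \<phi>2, \<phi>3}.
        \<phi> \<in> borel_measurable (restrict_space borel {0..T}) \<and> (\<forall>s\<in>{0..T}. 0 \<le> \<phi> s)) \<and>
     set_integrable lborel {0..T} \<phi>1 \<and>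
     set_integrable lborel {0..T} \<phi>2 \<and>
     set_integrable lborel {0..T} (\<lambda>s. \<phi>3 s * \<xi> s) \<and>
     (\<forall>t\<in>{0..T}.
        \<xi> t = skorohod (\<lambda>u. x0 + lam * (LINT s:{0..u}|lborel. \<phi>1 s)
                              - \<mu> * (LINT s:{0..u}|lborel. \<phi>2 s)
                              - \<theta> * (LINT s:{0..u}|lborel. \<phi>3 s * \<xi> s)) t \<and>
        \<zeta> t = \<theta> * (LINT s:{0..t}|lborel. \<phi>3 s * \<xi> s))}"

text \<open>The cost integrals have nonnegative integrands and may diverge; an infimum over the empty
  set in \<^typ>\<open>ennreal\<close> is \<open>\<infinity>\<close>.\<close>

definition rate_fun ::
  "real \<Rightarrow> real \<Rightarrow> real \<Rightarrow> real \<Rightarrow> real \<Rightarrow> (real \<Rightarrow> real) \<Rightarrow> (real \<Rightarrow> real) \<Rightarrow> ennreal" where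
  "rate_fun lam \<mu> \<theta> x0 T \<xi> \<zeta> =
     (INF (\<phi>1, \<phi>2, \<phi>3)\<in>controls lam \<mu> \<theta> x0 T \<xi> \<zeta>.
        ennreal lam * (\<integral>\<^sup>+ s\<in>{0..T}. ennreal (ell (\<phi>1 s)) \<partial>lborel)
      + ennreal \<mu> * (\<integral>\<^sup>+ s\<in>{0..T}. ennreal (ell (\<phi>2 s)) \<partial>lborel)
      + ennreal \<theta> * (\<integral>\<^sup>+ s\<in>{0..T}. ennreal (\<xi> s * ell (\<phi>3 s)) \<partial>lborel))"

definition I_eq :: "real \<Rightarrow> real \<Rightarrow> real \<Rightarrow> real \<Rightarrow> real \<Rightarrow> real \<Rightarrow> ennreal" where
  "I_eq lam \<mu> \<theta> x0 \<gamma> T =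
     (INF (\<xi>, \<zeta>)\<in>{(\<xi>, \<zeta>) \<in> paths T. \<zeta> T = \<gamma> * T}. rate_fun lam \<mu> \<theta> x0 T \<xi> \<zeta>)"

definition I_ge :: "real \<Rightarrow> real \<Rightarrow> real \<Rightarrow> real \<Rightarrow> real \<Rightarrow> real \<Rightarrow> ennreal" where
  "I_ge lam \<mu> \<theta> x0 \<gamma> T =
     (INF (\<xi>, \<zeta>)\<in>{(\<xi>, \<zeta>) \<in> paths T. \<zeta> T \<ge> \<gamma> * T}. rate_fun lam \<mu> \<theta> x0 T \<xi> \<zeta>)"

definition I_le :: "real \<Rightarrow> real \<Rightarrow> real \<Rightarrow> real \<Rightarrow> real \<Rightarrow> real \<Rightarrow> ennreal" where
  "I_le lam \<mu> \<theta> x0 \<gamma> T =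
     (INF (\<xi>, \<zeta>)\<in>{(\<xi>, \<zeta>) \<in> paths T. \<zeta> T \<le> \<gamma> * T}. rate_fun lam \<mu> \<theta> x0 T \<xi> \<zeta>)"

definition z_root :: "real \<Rightarrow> real \<Rightarrow> real \<Rightarrow> real" where
  "z_root lam \<mu> \<gamma> = (sqrt (\<gamma>\<^sup>2 + 4 * lam * \<mu>) - \<gamma>) / (2 * \<mu>)"

definition C_rate :: "real \<Rightarrow> real \<Rightarrow> real \<Rightarrow> real" where
  "C_rate lam \<mu> \<gamma> =
     lam * (1 - inverse (z_root lam \<mu> \<gamma>)) + \<mu> * (1 - z_root lam \<mu> \<gamma>)
       - \<gamma> * ln (z_root lam \<mu> \<gamma>)"

end

theory Submission
  imports Defs "HOL-Real_Asymp.Real_Asymp"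
begin

text \<open>Upper bound: steer \<open>\<xi>\<close> linearly to \<open>\<gamma>/\<theta>\<close> in unit time and then keep it there with the constant
  controls \<open>(1/z, z, 1)\<close>, where \<open>z = z\<^sub>\<gamma>\<close> solves \<open>\<lambda>/z - \<mu>z = \<gamma>\<close>; the running cost is then \<open>C(\<gamma>)\<close>.

  Lower bound: the tangent inequality \<open>\<ell>(x) \<ge> x log w - w + 1\<close> is applied with \<open>w = 1/z, z\<close> to the first
  two costs and with \<open>w = 1/z\<close> to the third, and the two resulting bounds are mixed with weights \<open>p(\<xi>)\<close>
  and \<open>1 - p(\<xi>)\<close>. By the chain rule for reflected paths the weighted net input is
  \<open>h(\<xi>(T)) - h(x\<^sub>0) - p(0) L(T)\<close>, where \<open>h' = p\<close> and \<open>L\<close> is the regulator. For \<open>\<gamma> \<ge> \<lambda> - \<mu>\<close> the harmful term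
  is \<open>L(T)\<close>, removed by a weight \<open>p(x) = x/(x + \<epsilon>)\<close> vanishing at \<open>0\<close>; for \<open>\<gamma> \<le> \<lambda> - \<mu>\<close> it is \<open>\<xi>(T)\<close>, removed
  by a weight \<open>p(x) = 1/(1 + \<epsilon>x)\<^sup>2\<close> with bounded primitive, since at large \<open>\<xi>\<close> the third cost alone
  dominates.\<close>


section \<open>Bounds for \<open>ell\<close> and integrals over subintervals\<close>

text \<open>By convexity: the left side is the tangent line of \<open>ell\<close> at
  \<open>w\<close>, as \<open>ell\<close> has derivative \<open>ln\<close>. After division by
  \<open>x\<close> the claim is \<open>ln y \<le> y - 1\<close> at \<open>y = w / x\<close>.\<close>

lemma ell_ge_tangent:
  assumes "0 \<le> x" "0 < w"
  shows "x * ln w - w + 1 \<le> ell x"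
proof (cases "x = 0")
  case False
  then have x: "0 < x" using assms by simp
  have "ln (w / x) \<le> w / x - 1"
    using x assms by (intro ln_le_minus_one) simp
  then have "x * (ln w - ln x) \<le> x * (w / x - 1)"
    using x assms by (simp add: ln_div)
  then show ?thesis using x by (simp add: ell_def algebra_simps)
qed (use assms in \<open>simp add: ell_def\<close>)

lemma ell_nonneg: "0 \<le> x \<Longrightarrow> 0 \<le> ell x"
  using ell_ge_tangent[of x 1] by simp

text \<open>From \<open>ln x \<le> x - 1\<close>. This crude bound controls the cost of the first
  unit of time in the upper bound.\<close>

lemma ell_le_square: "0 \<le> x \<Longrightarrow> ell x \<le> (x - 1)\<^sup>2"
proof (cases "x = 0")
  case False
  assume "0 \<le> x"
  with False have "x * ln x \<le> x * (x - 1)"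
    by (intro mult_left_mono ln_le_minus_one) auto
  then show ?thesis by (simp add: ell_def power2_eq_square algebra_simps)
qed (simp add: ell_def)

lemma set_integrable_mult_continuous:
  fixes g k :: "real \<Rightarrow> real"
  assumes "continuous_on {a..b} k" "set_integrable lborel {a..b} g"
  shows "set_integrable lborel {a..b} (\<lambda>s. k s * g s)"
proof -
  have "bounded (k ` {a..b})"
    using assms(1) by (intro compact_imp_bounded compact_continuous_image) auto
  then obtain B where B: "\<And>s. s \<in> {a..b} \<Longrightarrow> \<bar>k s\<bar> \<le> B"
    unfolding bounded_iff real_norm_def by blast
  have gi: "integrable lborel (\<lambda>s. indicator {a..b} s *\<^sub>R g s)"
    using assms(2) by (simp add: set_integrable_def)
  have km: "(\<lambda>s. indicator {a..b} s *\<^sub>R k s) \<in> borel_measurable borel"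
    using assms(1) by (intro borel_measurable_continuous_on_indicator) auto
  have eq: "(\<lambda>s. indicator {a..b} s *\<^sub>R (k s * g s)) =
      (\<lambda>s. (indicator {a..b} s *\<^sub>R k s) * (indicator {a..b} s *\<^sub>R g s))"
    by (auto simp: indicator_def)
  show ?thesis unfolding set_integrable_def
  proof (rule Bochner_Integration.integrable_bound)
    show "integrable lborel (\<lambda>s. B * (indicator {a..b} s *\<^sub>R g s))"
      using gi by simp
    show "(\<lambda>s. indicator {a..b} s *\<^sub>R (k s * g s)) \<in> borel_measurable lborel"
      unfolding eq using km gi by measurable
    show "AE s in lborel. norm (indicator {a..b} s *\<^sub>R (k s * g s))
        \<le> norm (B * (indicator {a..b} s *\<^sub>R g s))"
      using B by (intro AE_I2) (auto simp: indicator_def abs_mult intro!: mult_right_mono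
        order_trans[OF B abs_ge_self])
  qed
qed

lemma integrable_on_subset_interval:
  fixes g :: "real \<Rightarrow> real"
  assumes "set_integrable lborel {0..T} g" "0 \<le> s" "t \<le> T"
  shows "set_integrable lborel {s..t} g" "g integrable_on {s..t}"
    "(LINT u:{s..t}|lborel. g u) = integral {s..t} g"
proof -
  show *: "set_integrable lborel {s..t} g"
    by (rule set_integrable_subset[OF assms(1)]) (use assms in auto)
  show "g integrable_on {s..t}" "(LINT u:{s..t}|lborel. g u) = integral {s..t} g"
    using set_borel_integral_eq_integral[OF *] by auto
qed

lemma continuous_on_set_integral:
  fixes g :: "real \<Rightarrow> real"
  assumes "set_integrable lborel {0..T} g"
  shows "continuous_on {0..T} (\<lambda>t. LINT s:{0..t}|lborel. g s)"
proof (rule continuous_on_eq)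
  show "continuous_on {0..T} (\<lambda>t. integral {0..t} g)"
    by (rule indefinite_integral_continuous_1[OF integrable_on_subset_interval(2)[OF assms]]) auto
  show "integral {0..t} g = (LINT s:{0..t}|lborel. g s)" if "t \<in> {0..T}" for t
    using integrable_on_subset_interval(3)[OF assms order_refl, of t] that by simp
qed

text \<open>Telescoping over a partition of mesh below \<open>\<eta>\<close>. \<open>M\<close> acts
  as a distribution function dominating the variation of \<open>G\<close>, so the local estimates
  add up without loss.\<close>

lemma increment_bound_local_to_global:
  fixes G M :: "real \<Rightarrow> real"
  assumes "0 < \<eta>" "0 \<le> T"
    and loc: "\<And>s t. 0 \<le> s \<Longrightarrow> s \<le> t \<Longrightarrow> t \<le> T \<Longrightarrow> t - s < \<eta> \<Longrightarrow> \<bar>G t - G s\<bar> \<le> M t - M s"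
  shows "\<bar>G T - G 0\<bar> \<le> M T - M 0"
proof -
  obtain n :: nat where n: "T / \<eta> < real n" using reals_Archimedean2 by blast
  then have n0: "0 < real n" using assms(1,2) by (smt (verit) divide_nonneg_pos)
  have *: "\<bar>G (real k * T / n) - G 0\<bar> \<le> M (real k * T / n) - M 0" if "k \<le> n" for k
    using that
  proof (induction k)
    case (Suc k)
    have "\<bar>G (real (Suc k) * T / n) - G (real k * T / n)\<bar>
        \<le> M (real (Suc k) * T / n) - M (real k * T / n)"
    proof (rule loc)
      show "0 \<le> real k * T / n" using assms by simp
      show "real k * T / n \<le> real (Suc k) * T / n"
        using assms by (intro divide_right_mono mult_right_mono) auto
      show "real (Suc k) * T / n \<le> T"
        using assms Suc.prems n0 mult_right_mono[of "real (Suc k)" "real n" T]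
        by (simp add: divide_le_eq mult.commute)
      show "real (Suc k) * T / n - real k * T / n < \<eta>"
        using n n0 assms(1) by (simp add: field_simps)
    qed
    then show ?case using Suc by simp
  qed simp
  show ?thesis using *[of n] n0 by simp
qed

subsection \<open>The Skorohod map\<close>

text \<open>\<open>L\<close> is minus the running minimum of \<open>min \<psi> 0\<close>, which is
  attained by continuity; all three facts are read off the minimisers. The third is the
  complementarity condition in a form that avoids Stieltjes integrals.\<close>

lemma skorohod_regulator:
  fixes \<psi> L :: "real \<Rightarrow> real"
  assumes cont: "continuous_on {0..T} \<psi>" and L_def: "\<And>t. L t = skorohod \<psi> t - \<psi> t"
  shows "\<And>t. 0 \<le> t \<Longrightarrow> t \<le> T \<Longrightarrow> 0 \<le> L t"
    and "\<And>s t. 0 \<le> s \<Longrightarrow> s \<le> t \<Longrightarrow> t \<le> T \<Longrightarrow> L s \<le> L t"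
    and "\<And>s t. 0 \<le> s \<Longrightarrow> s \<le> t \<Longrightarrow> t \<le> T \<Longrightarrow> L s < L t \<Longrightarrow> \<exists>u\<in>{s..t}. skorohod \<psi> u = 0"
proof -
  have L: "L t = - (INF s\<in>{0..t}. min (\<psi> s) 0)" for t
    by (simp add: L_def skorohod_def)
  have att: "\<exists>u\<in>{0..t}. L t = - min (\<psi> u) 0 \<and> (\<forall>v\<in>{0..t}. min (\<psi> u) 0 \<le> min (\<psi> v) 0)"
    if "0 \<le> t" "t \<le> T" for t
  proof -
    have "continuous_on {0..t} (\<lambda>s. min (\<psi> s) 0)"
      using that by (intro continuous_intros continuous_on_subset[OF cont]) auto
    moreover have "{0..t} \<noteq> {}" using that by auto
    ultimately obtain u where u: "u \<in> {0..t}" "\<forall>v\<in>{0..t}. min (\<psi> u) 0 \<le> min (\<psi> v) 0"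
      using continuous_attains_inf[OF compact_Icc] by blast
    have "(INF s\<in>{0..t}. min (\<psi> s) 0) = min (\<psi> u) 0"
      using u by (intro cInf_eq_minimum) auto
    then show ?thesis using u L by auto
  qed
  show nn: "0 \<le> L t" if "0 \<le> t" "t \<le> T" for t
    using att[OF that] by auto
  show mono: "L s \<le> L t" if st: "0 \<le> s" "s \<le> t" "t \<le> T" for s t
  proof -
    obtain u where u: "u \<in> {0..s}" "L s = - min (\<psi> u) 0" using att[of s] st by force
    obtain v where "L t = - min (\<psi> v) 0" "\<forall>w\<in>{0..t}. min (\<psi> v) 0 \<le> min (\<psi> w) 0"
      using att[of t] st by force
    then show ?thesis using u st by auto
  qed
  show "\<exists>u\<in>{s..t}. skorohod \<psi> u = 0" if st: "0 \<le> s" "s \<le> t" "t \<le> T" and lt: "L s < L t" for s t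
  proof -
    obtain u where u: "u \<in> {0..t}" "L t = - min (\<psi> u) 0"
      "\<And>v. v \<in> {0..t} \<Longrightarrow> min (\<psi> u) 0 \<le> min (\<psi> v) 0" using att[of t] st by force
    obtain v where v: "v \<in> {0..s}" "L s = - min (\<psi> v) 0"
      "\<And>w. w \<in> {0..s} \<Longrightarrow> min (\<psi> v) 0 \<le> min (\<psi> w) 0" using att[of s] st by force
    \<comment> \<open>A minimiser for \<open>{0..t}\<close> lying in \<open>{0..s}\<close> would
      force \<open>L t \<le> L s\<close>.\<close>
    have us: "s \<le> u" using u(1,2) v(2) v(3)[of u] lt by fastforce
    have neg: "\<psi> u < 0" using nn[of s] st lt u(2) by (auto simp: min_def split: if_splits)
    \<comment> \<open>\<open>u\<close> also minimises over the shorter interval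
      \<open>{0..u}\<close>, so the reflected path at \<open>u\<close> is
      \<open>\<psi> u - \<psi> u\<close>.\<close>
    have "(INF s\<in>{0..u}. min (\<psi> s) 0) = min (\<psi> u) 0"
      using u by (intro cInf_eq_minimum) auto
    then have "skorohod \<psi> u = 0" using neg by (simp add: skorohod_def)
    then show ?thesis using us u(1) by auto
  qed
qed

lemma skorohod_nonneg_path:
  assumes "0 \<le> t" "\<And>s. 0 \<le> s \<Longrightarrow> s \<le> t \<Longrightarrow> 0 \<le> \<psi> s"
  shows "skorohod \<psi> t = \<psi> t"
proof -
  have "(INF s\<in>{0..t}. min (\<psi> s) 0) = (INF s\<in>{0..t}. 0)"
    using assms(2) by (intro INF_cong) auto
  then show ?thesis using assms(1) by (simp add: skorohod_def)
qed

text \<open>Formally \<open>d\<xi> = g dt + dL\<close>, hence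
  \<open>d h(\<xi>) = p(\<xi>) g dt + p(\<xi>) dL\<close>, and \<open>L\<close> grows only where
  \<open>\<xi> = 0\<close>, which turns the last term into \<open>p(0) dL\<close>. As
  \<open>g\<close> is merely integrable and \<open>L\<close> merely monotone, the identity is proved
  through increments over short intervals instead of differentiation.\<close>

lemma skorohod_chain_rule:
  fixes g \<xi> h p :: "real \<Rightarrow> real" and T x0 :: real
  defines "\<psi> \<equiv> \<lambda>t. x0 + (LINT s:{0..t}|lborel. g s)"
  assumes T: "0 \<le> T" and x0: "0 \<le> x0" and gi: "set_integrable lborel {0..T} g"
    and \<xi>: "\<And>t. t \<in> {0..T} \<Longrightarrow> \<xi> t = skorohod \<psi> t"
    and \<xi>c: "continuous_on {0..T} \<xi>" and \<xi>0: "\<And>t. t \<in> {0..T} \<Longrightarrow> 0 \<le> \<xi> t"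
    and h: "\<And>x. 0 \<le> x \<Longrightarrow> (h has_real_derivative p x) (at x)"
    and pc: "continuous_on {0..} p"
  shows "(LINT s:{0..T}|lborel. p (\<xi> s) * g s) = h (\<xi> T) - h x0 - p 0 * (\<xi> T - \<psi> T)"
proof -
  define P where "P = (\<lambda>s. p (\<xi> s))"
  define L where "L = (\<lambda>t. skorohod \<psi> t - \<psi> t)"
  have Pc: "continuous_on {0..T} P"
    unfolding P_def using \<xi>0 by (intro continuous_on_compose2[OF pc \<xi>c]) auto
  have Pg: "set_integrable lborel {0..T} (\<lambda>s. P s * g s)"
    by (rule set_integrable_mult_continuous[OF Pc gi])
  have ag: "set_integrable lborel {0..T} (\<lambda>s. \<bar>g s\<bar>)"
    using set_integrable_abs[OF gi] .
  note gI = integrable_on_subset_interval[OF gi] and PgI = integrable_on_subset_interval[OF Pg]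
    and agI = integrable_on_subset_interval[OF ag]
  have \<psi>eq: "\<psi> t = x0 + integral {0..t} g" if "0 \<le> t" "t \<le> T" for t
    using gI(3)[of 0 t] that by (simp add: \<psi>_def)
  have \<psi>c: "continuous_on {0..T} \<psi>"
    unfolding \<psi>_def by (intro continuous_intros continuous_on_set_integral gi)
  have Leq: "L t = skorohod \<psi> t - \<psi> t" for t by (simp add: L_def)
  note reg = skorohod_regulator[OF \<psi>c Leq]
  have \<xi>L: "\<xi> t = \<psi> t + L t" if "t \<in> {0..T}" for t using \<xi>[OF that] by (simp add: L_def)
  have \<psi>0: "\<psi> 0 = x0" using \<psi>eq[of 0] T by simp
  have sk0: "skorohod \<psi> 0 = x0"
    using skorohod_nonneg_path[of 0 \<psi>] \<psi>0 x0 by (smt (verit))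
  then have L0: "L 0 = 0" and \<xi>x0: "\<xi> 0 = x0" using \<psi>0 \<xi>[of 0] T by (auto simp: L_def)
  \<comment> \<open>Up to a constant, \<open>G\<close> is the defect of the claimed identity at time
    \<open>t\<close>, and \<open>M\<close> measures the variation of the drivers \<open>g dt\<close>
    and \<open>dL\<close>. The increment of \<open>G\<close> is at most \<open>\<delta>\<close>
    times that of \<open>M\<close> for every \<open>\<delta> > 0\<close>, so it vanishes.\<close>
  define G where "G = (\<lambda>t. integral {0..t} (\<lambda>s. P s * g s) - h (\<xi> t) + p 0 * L t)"
  define M where "M = (\<lambda>t. integral {0..t} (\<lambda>s. \<bar>g s\<bar>) + L t)"
  have key: "\<bar>G T - G 0\<bar> \<le> \<delta> * (M T - M 0)" if \<delta>: "0 < \<delta>" for \<delta>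
  proof -
    have "uniformly_continuous_on {0..T} P"
      using Pc by (intro compact_uniformly_continuous) auto
    then obtain \<eta> where \<eta>: "0 < \<eta>"
      "\<And>s t. s \<in> {0..T} \<Longrightarrow> t \<in> {0..T} \<Longrightarrow> \<bar>s - t\<bar> < \<eta> \<Longrightarrow> \<bar>P s - P t\<bar> < \<delta>"
      unfolding uniformly_continuous_on_def dist_real_def using \<delta> by metis
    have "\<bar>G T - G 0\<bar> \<le> (\<lambda>t. \<delta> * M t) T - (\<lambda>t. \<delta> * M t) 0"
    proof (rule increment_bound_local_to_global[OF \<eta>(1) T])
      fix s t assume st: "0 \<le> s" "s \<le> t" "t \<le> T" "t - s < \<eta>"
      \<comment> \<open>The intermediate value of the mean value theorem is attained by \<open>\<xi>\<close> on \<open>[s,t]\<close>, so uniform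
        continuity of \<open>p \<circ> \<xi>\<close> suffices.\<close>
      obtain w where w: "w \<in> {s..t}" "h (\<xi> t) - h (\<xi> s) = P w * (\<xi> t - \<xi> s)"
      proof -
        have IVT: "\<exists>w\<in>{s..t}. \<xi> w = c" if "min (\<xi> s) (\<xi> t) \<le> c" "c \<le> max (\<xi> s) (\<xi> t)" for c
        proof -
          have c: "continuous_on {s..t} \<xi>" using st by (intro continuous_on_subset[OF \<xi>c]) auto
          show ?thesis
            using IVT'[of \<xi> s c t] IVT2'[of \<xi> t c s] that st c
            by (cases "\<xi> s \<le> \<xi> t") (auto simp: Bex_def)
        qed
        have nn: "0 \<le> \<xi> s" "0 \<le> \<xi> t" using \<xi>0 st by auto
        have "\<exists>c. min (\<xi> s) (\<xi> t) \<le> c \<and> c \<le> max (\<xi> s) (\<xi> t) \<and> h (\<xi> t) - h (\<xi> s) = p c * (\<xi> t - \<xi> s)"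
        proof (cases "\<xi> s" "\<xi> t" rule: linorder_cases)
          case less
          then obtain c where "\<xi> s < c" "c < \<xi> t" "h (\<xi> t) - h (\<xi> s) = (\<xi> t - \<xi> s) * p c"
            using MVT2[OF less, of h p] h nn by force
          then show ?thesis by (intro exI[of _ c]) (auto simp: mult.commute)
        next
          case greater
          then obtain c where "\<xi> t < c" "c < \<xi> s" "h (\<xi> s) - h (\<xi> t) = (\<xi> s - \<xi> t) * p c"
            using MVT2[OF greater, of h p] h nn by force
          then show ?thesis by (intro exI[of _ c]) (auto simp: algebra_simps)
        qed auto
        with IVT that show thesis unfolding P_def by metis
      qed
      have close: "\<bar>P u - P w\<bar> \<le> \<delta>" if "u \<in> {s..t}" for u
        using \<eta>(2)[of u w] that w(1) st by force
      have split: "integral {0..t} k = integral {0..s} k + integral {s..t} k"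
        if "k integrable_on {0..t}" for k :: "real \<Rightarrow> real"
        using Henstock_Kurzweil_Integration.integral_combine[OF st(1,2) that] by simp
      have d\<xi>: "\<xi> t - \<xi> s = integral {s..t} g + (L t - L s)"
        using \<xi>L[of t] \<xi>L[of s] \<psi>eq[of t] \<psi>eq[of s] split[OF gI(2)[of 0 t]] st by simp
      have dint: "integral {s..t} (\<lambda>u. P u * g u) - P w * integral {s..t} g
          = integral {s..t} (\<lambda>u. (P u - P w) * g u)"
        using integral_diff[OF PgI(2)[of s t] integrable_on_cmult_left[OF gI(2)[of s t], of "P w"]] st
        by (simp add: algebra_simps)
      have "\<bar>integral {s..t} (\<lambda>u. (P u - P w) * g u)\<bar> \<le> integral {s..t} (\<lambda>u. \<delta> * \<bar>g u\<bar>)"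
      proof -
        have "(\<lambda>u. (P u - P w) * g u) integrable_on {s..t}"
          using integrable_diff[OF PgI(2)[of s t] integrable_on_cmult_left[OF gI(2)[of s t], of "P w"]] st
          by (simp add: algebra_simps)
        then show ?thesis
          using integrable_on_cmult_left[OF agI(2)[of s t], of \<delta>] st close
          by (intro integral_norm_bound_integral[where 'a=real, unfolded real_norm_def])
             (auto simp: abs_mult intro!: mult_right_mono)
      qed
      then have I1: "\<bar>integral {s..t} (\<lambda>u. P u * g u) - P w * integral {s..t} g\<bar>
          \<le> \<delta> * integral {s..t} (\<lambda>u. \<bar>g u\<bar>)"
        using dint by simp
      \<comment> \<open>If \<open>L\<close> grows over \<open>{s..t}\<close>, then
        \<open>\<xi>\<close> vanishes somewhere in it, so \<open>p 0\<close> is a value of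
        \<open>P\<close> on the same short interval as \<open>P w\<close>.\<close>
      have I2: "\<bar>(P w - p 0) * (L t - L s)\<bar> \<le> \<delta> * (L t - L s)"
      proof (cases "L s < L t")
        case True
        then obtain u where u: "u \<in> {s..t}" "skorohod \<psi> u = 0" using reg(3)[of s t] st by auto
        then have "P u = p 0" using \<xi>[of u] st by (auto simp: P_def)
        then have "\<bar>P w - p 0\<bar> \<le> \<delta>" using close[OF u(1)] by simp
        then show ?thesis using True by (simp add: abs_mult mult_right_mono)
      next
        case False
        then have "L t = L s" using reg(2)[of s t] st by simp
        then show ?thesis by simp
      qed
      have "G t - G s = (integral {s..t} (\<lambda>u. P u * g u) - P w * integral {s..t} g)
          - (P w - p 0) * (L t - L s)"
        using w(2) split[OF PgI(2)[of 0 t]] st unfolding G_def d\<xi> by (simp add: algebra_simps)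
      moreover have "M t - M s = integral {s..t} (\<lambda>u. \<bar>g u\<bar>) + (L t - L s)"
        using split[OF agI(2)[of 0 t]] st unfolding M_def by simp
      ultimately show "\<bar>G t - G s\<bar> \<le> \<delta> * M t - \<delta> * M s"
        using I1 I2 by (simp add: right_diff_distrib[symmetric] distrib_left)
    qed
    then show ?thesis by (simp add: algebra_simps)
  qed
  have "\<bar>G T - G 0\<bar> \<le> 0"
  proof (rule field_le_epsilon)
    fix e :: real assume e: "0 < e"
    \<comment> \<open>Adding \<open>1\<close> keeps the divisor positive even if
      \<open>M T = M 0\<close>.\<close>
    define m where "m = \<bar>M T - M 0\<bar> + 1"
    have m: "0 < m" "M T - M 0 \<le> m" by (auto simp: m_def)
    have "\<bar>G T - G 0\<bar> \<le> e / m * (M T - M 0)" using key[of "e / m"] e m by simp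
    also have "\<dots> \<le> e / m * m" using e m by (intro mult_left_mono) auto
    finally show "\<bar>G T - G 0\<bar> \<le> 0 + e" using m by simp
  qed
  then have "integral {0..T} (\<lambda>s. P s * g s) = h (\<xi> T) - h x0 - p 0 * L T"
    by (simp add: G_def L0 \<xi>x0)
  then show ?thesis
    using PgI(3)[of 0 T] T \<xi>[of T] by (simp add: P_def L_def)
qed


subsection \<open>Lower bounds on the cost\<close>

text \<open>The functional under the infimum in \<open>rate_fun\<close>: estimates are made for one
  admissible triple at a time and passed to the infima afterwards.\<close>

definition control_cost ::
  "real \<Rightarrow> real \<Rightarrow> real \<Rightarrow> real \<Rightarrow> (real \<Rightarrow> real) \<Rightarrow> (real \<Rightarrow> real) \<Rightarrow> (real \<Rightarrow> real) \<Rightarrow> (real \<Rightarrow> real)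
    \<Rightarrow> ennreal" where
  "control_cost lam \<mu> \<theta> T \<xi> \<phi>1 \<phi>2 \<phi>3 =
     ennreal lam * (\<integral>\<^sup>+ s\<in>{0..T}. ennreal (ell (\<phi>1 s)) \<partial>lborel)
   + ennreal \<mu> * (\<integral>\<^sup>+ s\<in>{0..T}. ennreal (ell (\<phi>2 s)) \<partial>lborel)
   + ennreal \<theta> * (\<integral>\<^sup>+ s\<in>{0..T}. ennreal (\<xi> s * ell (\<phi>3 s)) \<partial>lborel)"

lemma ell_measurable [measurable]: "ell \<in> borel_measurable borel"
  unfolding ell_def[abs_def] by measurable

text \<open>A single integral permits pointwise comparison of the whole running cost. It is taken
  over the restricted space because the controls are assumed measurable only on
  \<open>{0..T}\<close>.\<close>

lemma control_cost_eq:
  assumes "0 < lam" "0 < \<mu>" "0 < \<theta>"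
    and meas: "\<phi>1 \<in> borel_measurable (restrict_space borel {0..T})"
      "\<phi>2 \<in> borel_measurable (restrict_space borel {0..T})"
      "\<phi>3 \<in> borel_measurable (restrict_space borel {0..T})"
    and nn: "\<And>s. s \<in> {0..T} \<Longrightarrow> 0 \<le> \<phi>1 s \<and> 0 \<le> \<phi>2 s \<and> 0 \<le> \<phi>3 s \<and> 0 \<le> \<xi> s"
    and \<xi>c: "continuous_on {0..T} \<xi>"
  shows "control_cost lam \<mu> \<theta> T \<xi> \<phi>1 \<phi>2 \<phi>3 =
    (\<integral>\<^sup>+ s. ennreal (lam * ell (\<phi>1 s) + \<mu> * ell (\<phi>2 s) + \<theta> * (\<xi> s * ell (\<phi>3 s)))
      \<partial>restrict_space lborel {0..T})"
proof -
  let ?N = "restrict_space lborel {0..T}"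
  have N: "sets ?N = sets (restrict_space borel {0..T})"
    by (rule sets_restrict_space_cong) simp
  have sp: "space ?N = {0..T}" by simp
  have [measurable]: "\<phi>1 \<in> borel_measurable ?N" "\<phi>2 \<in> borel_measurable ?N" "\<phi>3 \<in> borel_measurable ?N"
    using meas measurable_cong_sets[OF N refl] by auto
  have [measurable]: "\<xi> \<in> borel_measurable ?N"
    using borel_measurable_continuous_on_restrict[OF \<xi>c] measurable_cong_sets[OF N refl] by auto
  have "control_cost lam \<mu> \<theta> T \<xi> \<phi>1 \<phi>2 \<phi>3 =
     ennreal lam * (\<integral>\<^sup>+ s. ennreal (ell (\<phi>1 s)) \<partial>?N)
   + ennreal \<mu> * (\<integral>\<^sup>+ s. ennreal (ell (\<phi>2 s)) \<partial>?N)
   + ennreal \<theta> * (\<integral>\<^sup>+ s. ennreal (\<xi> s * ell (\<phi>3 s)) \<partial>?N)"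
    by (simp add: control_cost_def nn_integral_restrict_space)
  also have "\<dots> = (\<integral>\<^sup>+ s. ennreal lam * ennreal (ell (\<phi>1 s)) + ennreal \<mu> * ennreal (ell (\<phi>2 s))
      + ennreal \<theta> * ennreal (\<xi> s * ell (\<phi>3 s)) \<partial>?N)"
    by (subst nn_integral_add, measurable)+ (subst nn_integral_cmult, measurable)+
  also have "\<dots> = (\<integral>\<^sup>+ s. ennreal (lam * ell (\<phi>1 s) + \<mu> * ell (\<phi>2 s) + \<theta> * (\<xi> s * ell (\<phi>3 s))) \<partial>?N)"
    using assms(1-3) nn
    by (intro nn_integral_cong) (simp add: sp ennreal_mult ell_nonneg ennreal_plus)
  finally show ?thesis .
qed

text \<open>The minorant \<open>q\<close> may be negative, and \<open>ennreal\<close> sends negative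
  values to \<open>0\<close>. Passing through \<open>max (q s) 0\<close> handles this, since
  truncation only increases the integral.\<close>

lemma ennreal_integral_le_nn_integral:
  fixes q k :: "'a \<Rightarrow> real"
  assumes "integrable N q" "\<And>s. s \<in> space N \<Longrightarrow> q s \<le> k s"
  shows "ennreal (integral\<^sup>L N q) \<le> (\<integral>\<^sup>+ s. ennreal (k s) \<partial>N)"
proof -
  have i: "integrable N (\<lambda>s. max (q s) 0)" using assms(1) by simp
  have "integral\<^sup>L N q \<le> integral\<^sup>L N (\<lambda>s. max (q s) 0)"
    using assms(1) i by (intro integral_mono) auto
  then have "ennreal (integral\<^sup>L N q) \<le> ennreal (integral\<^sup>L N (\<lambda>s. max (q s) 0))"
    by (rule ennreal_leI)
  also have "\<dots> = (\<integral>\<^sup>+ s. ennreal (max (q s) 0) \<partial>N)"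
    using i by (intro nn_integral_eq_integral[symmetric]) auto
  also have "\<dots> \<le> (\<integral>\<^sup>+ s. ennreal (k s) \<partial>N)"
    using assms(2) by (intro nn_integral_mono) (auto simp: max_def ennreal_leI)
  finally show ?thesis .
qed

text \<open>Nonnegative costs satisfy \<open>A + B \<ge> P * A + (1 - P) * B\<close>, where
  \<open>A\<close> is the running cost of the first two controls, \<open>B\<close> that of the
  third, and \<open>P = p (\<xi> s)\<close>. Tangent bounds make the right side affine in the
  controls: its constant part is at least \<open>m\<close> by hypothesis, and its linear part is
  integrated exactly by the chain rule. The witness for \<open>L\<close> is the regulator at time
  \<open>T\<close>.\<close>

lemma control_cost_ge:
  fixes h p :: "real \<Rightarrow> real"
  assumes pos: "0 < lam" "0 < \<mu>" "0 < \<theta>" and x0: "0 \<le> x0" and T: "0 \<le> T" and z: "0 < z"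
    and path: "(\<xi>, \<zeta>) \<in> paths T" and ctl: "(\<phi>1, \<phi>2, \<phi>3) \<in> controls lam \<mu> \<theta> x0 T \<xi> \<zeta>"
    and h: "\<And>x. 0 \<le> x \<Longrightarrow> (h has_real_derivative p x) (at x)"
    and pc: "continuous_on {0..} p" and p: "\<And>x. 0 \<le> x \<Longrightarrow> 0 \<le> p x \<and> p x \<le> 1"
    and m: "\<And>x. 0 \<le> x \<Longrightarrow> m \<le> p x * (lam * (1 - inverse z) + \<mu> * (1 - z))
          + (1 - p x) * (\<theta> * x * (1 - inverse z))"
  shows "\<exists>L\<ge>0. ennreal (m * T - ln z * (h (\<xi> T) - h x0 - p 0 * L + \<zeta> T))
    \<le> control_cost lam \<mu> \<theta> T \<xi> \<phi>1 \<phi>2 \<phi>3"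
proof -
  define g where "g = (\<lambda>s. lam * \<phi>1 s - \<mu> * \<phi>2 s - \<theta> * (\<phi>3 s * \<xi> s))"
  define \<psi> where "\<psi> = (\<lambda>t. x0 + (LINT s:{0..t}|lborel. g s))"
  have \<xi>c: "continuous_on {0..T} \<xi>" and \<xi>0: "\<And>t. t \<in> {0..T} \<Longrightarrow> 0 \<le> \<xi> t"
    using path by (auto simp: paths_def)
  have meas: "\<phi>1 \<in> borel_measurable (restrict_space borel {0..T})"
      "\<phi>2 \<in> borel_measurable (restrict_space borel {0..T})"
      "\<phi>3 \<in> borel_measurable (restrict_space borel {0..T})"
    and nn: "\<And>s. s \<in> {0..T} \<Longrightarrow> 0 \<le> \<phi>1 s \<and> 0 \<le> \<phi>2 s \<and> 0 \<le> \<phi>3 s"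
    and i1: "set_integrable lborel {0..T} \<phi>1" and i2: "set_integrable lborel {0..T} \<phi>2"
    and i3: "set_integrable lborel {0..T} (\<lambda>s. \<phi>3 s * \<xi> s)"
    and \<xi>': "\<And>t. t \<in> {0..T} \<Longrightarrow> \<xi> t = skorohod (\<lambda>u. x0 + lam * (LINT s:{0..u}|lborel. \<phi>1 s)
                              - \<mu> * (LINT s:{0..u}|lborel. \<phi>2 s)
                              - \<theta> * (LINT s:{0..u}|lborel. \<phi>3 s * \<xi> s)) t"
    and \<zeta>: "\<And>t. t \<in> {0..T} \<Longrightarrow> \<zeta> t = \<theta> * (LINT s:{0..t}|lborel. \<phi>3 s * \<xi> s)"
    using ctl unfolding controls_def by auto
  have gi: "set_integrable lborel {0..T} g"
    unfolding g_def using i1 i2 i3 by (intro set_integral_diff(1) set_integrable_mult_right) auto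
  have \<psi>eq: "\<psi> u = x0 + lam * (LINT s:{0..u}|lborel. \<phi>1 s) - \<mu> * (LINT s:{0..u}|lborel. \<phi>2 s)
      - \<theta> * (LINT s:{0..u}|lborel. \<phi>3 s * \<xi> s)" if "u \<in> {0..T}" for u
  proof -
    note sub = integrable_on_subset_interval(1)[OF _ order_refl, of T _ u]
    have "set_integrable lborel {0..u} \<phi>1" "set_integrable lborel {0..u} \<phi>2"
      "set_integrable lborel {0..u} (\<lambda>s. \<phi>3 s * \<xi> s)"
      using sub[OF i1] sub[OF i2] sub[OF i3] that by auto
    then show ?thesis unfolding \<psi>_def g_def
      by (simp add: set_integral_diff)
  qed
  have \<xi>: "\<xi> t = skorohod \<psi> t" if "t \<in> {0..T}" for t
  proof -
    have "(INF s\<in>{0..t}. min (\<psi> s) 0) = (INF u\<in>{0..t}. min (x0 + lam * (LINT s:{0..u}|lborel. \<phi>1 s)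
        - \<mu> * (LINT s:{0..u}|lborel. \<phi>2 s) - \<theta> * (LINT s:{0..u}|lborel. \<phi>3 s * \<xi> s)) 0)"
      using \<psi>eq that by (intro INF_cong) auto
    then show ?thesis using \<xi>'[OF that] \<psi>eq[OF that] by (simp add: skorohod_def)
  qed
  have chain: "(LINT s:{0..T}|lborel. p (\<xi> s) * g s) = h (\<xi> T) - h x0 - p 0 * (\<xi> T - \<psi> T)"
    using skorohod_chain_rule[OF T x0 gi \<xi>[unfolded \<psi>_def] \<xi>c \<xi>0 h pc] unfolding \<psi>_def by simp
  have Pc: "continuous_on {0..T} (\<lambda>s. p (\<xi> s))"
    using \<xi>0 by (intro continuous_on_compose2[OF pc \<xi>c]) auto
  note Pg = set_integrable_mult_continuous[OF Pc gi]
  have L: "0 \<le> \<xi> T - \<psi> T"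
  proof -
    have "(INF s\<in>{0..T}. min (\<psi> s) 0) \<le> 0"
    proof -
      have "continuous_on {0..T} \<psi>"
        unfolding \<psi>_def by (intro continuous_intros continuous_on_set_integral gi)
      from skorohod_regulator(1)[OF this refl, of T] T show ?thesis by (simp add: skorohod_def)
    qed
    then show ?thesis using \<xi>[of T] T by (simp add: skorohod_def)
  qed
  let ?N = "restrict_space lborel {0..T}"
  \<comment> \<open>The affine minorant. Abandonment must occur with weight
    \<open>1 - p (\<xi> s)\<close>: it is written in full, and the product with \<open>g\<close>
    takes away the fraction \<open>p (\<xi> s)\<close>.\<close>
  define q where "q = (\<lambda>s. m - ln z * (p (\<xi> s) * g s + \<theta> * (\<phi>3 s * \<xi> s)))"
  have mi: "set_integrable lborel {0..T} (\<lambda>s. m)"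
    by (intro borel_integrable_atLeastAtMost' continuous_on_const)
  have qi: "set_integrable lborel {0..T} q" unfolding q_def
    using mi Pg i3 by (intro set_integral_diff(1) set_integrable_mult_right set_integral_add(1)) auto
  have "(LINT s:{0..T}|lborel. q s) = m * T - ln z * (h (\<xi> T) - h x0 - p 0 * (\<xi> T - \<psi> T) + \<zeta> T)"
  proof -
    have "(LINT s:{0..T}|lborel. q s) = (LINT s:{0..T}|lborel. m)
       - ln z * ((LINT s:{0..T}|lborel. p (\<xi> s) * g s) + \<theta> * (LINT s:{0..T}|lborel. \<phi>3 s * \<xi> s))"
      unfolding q_def using mi Pg i3
      by (simp add: set_integral_diff set_integral_add)
    then show ?thesis using chain \<zeta>[of T] T by (simp add: set_lebesgue_integral_def)
  qed
  moreover have "(LINT s:{0..T}|lborel. q s) = integral\<^sup>L ?N q"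
    by (simp add: integral_restrict_space set_lebesgue_integral_def)
  moreover have "ennreal (integral\<^sup>L ?N q) \<le> control_cost lam \<mu> \<theta> T \<xi> \<phi>1 \<phi>2 \<phi>3"
  proof -
    have "q s \<le> lam * ell (\<phi>1 s) + \<mu> * ell (\<phi>2 s) + \<theta> * (\<xi> s * ell (\<phi>3 s))" if s: "s \<in> {0..T}" for s
    proof -
      define A where "A = lam * ell (\<phi>1 s) + \<mu> * ell (\<phi>2 s)"
      define B where "B = \<theta> * (\<xi> s * ell (\<phi>3 s))"
      \<comment> \<open>The tangent points \<open>inverse z\<close>, \<open>z\<close> and, in
        \<open>B'\<close>, \<open>inverse z\<close> give every linear term the common factor
        \<open>ln z\<close>.\<close>
      define A' where "A' = lam * (1 - inverse z) + \<mu> * (1 - z) - ln z * (lam * \<phi>1 s - \<mu> * \<phi>2 s)"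
      define B' where "B' = \<theta> * \<xi> s * (1 - inverse z) - ln z * (\<theta> * (\<phi>3 s * \<xi> s))"
      have nn': "0 \<le> \<phi>1 s" "0 \<le> \<phi>2 s" "0 \<le> \<phi>3 s" "0 \<le> \<xi> s" using nn \<xi>0 s by auto
      have "lam * (\<phi>1 s * ln (inverse z) - inverse z + 1) \<le> lam * ell (\<phi>1 s)"
           "\<mu> * (\<phi>2 s * ln z - z + 1) \<le> \<mu> * ell (\<phi>2 s)"
           "\<theta> * (\<xi> s * (\<phi>3 s * ln (inverse z) - inverse z + 1)) \<le> \<theta> * (\<xi> s * ell (\<phi>3 s))"
        using pos z nn' by (intro mult_left_mono ell_ge_tangent; simp)+
      then have AB: "A' \<le> A" "B' \<le> B" using z unfolding A_def B_def A'_def B'_def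
        by (simp_all add: ln_inverse algebra_simps)
      have AB0: "0 \<le> A" "0 \<le> B" using pos nn' unfolding A_def B_def by (auto simp: ell_nonneg)
      define P where "P = p (\<xi> s)"
      have P: "0 \<le> P" "P \<le> 1" using p nn' unfolding P_def by auto
      have "m \<le> P * (lam * (1 - inverse z) + \<mu> * (1 - z)) + (1 - P) * (\<theta> * \<xi> s * (1 - inverse z))"
        unfolding P_def by (rule m[OF nn'(4)])
      then have "q s \<le> P * A' + (1 - P) * B'"
        unfolding q_def g_def A'_def B'_def P_def[symmetric] by (simp add: algebra_simps)
      also have "\<dots> \<le> P * A + (1 - P) * B" using AB P by (intro add_mono mult_left_mono) auto
      also have "\<dots> \<le> 1 * A + 1 * B" using AB0 P by (intro add_mono mult_right_mono) auto
      finally show ?thesis by (simp add: A_def B_def)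
    qed
    moreover have "integrable ?N q" using qi by (simp add: integrable_restrict_space set_integrable_def)
    moreover have "control_cost lam \<mu> \<theta> T \<xi> \<phi>1 \<phi>2 \<phi>3 =
      (\<integral>\<^sup>+ s. ennreal (lam * ell (\<phi>1 s) + \<mu> * ell (\<phi>2 s) + \<theta> * (\<xi> s * ell (\<phi>3 s))) \<partial>?N)"
      using nn \<xi>0 by (intro control_cost_eq[OF pos meas _ \<xi>c]) auto
    ultimately show ?thesis by (auto intro!: ennreal_integral_le_nn_integral)
  qed
  ultimately show ?thesis using L by (intro exI[of _ "\<xi> T - \<psi> T"]) simp
qed


section \<open>The root \<open>z_root\<close> and the rate \<open>C_rate\<close>\<close>

text \<open>\<open>z\<close> is the positive root of
  \<open>\<mu> * z\<^sup>2 + \<gamma> * z = lam\<close>. Divided by \<open>z\<close>, this says that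
  the tilted arrival rate exceeds the tilted service rate by the abandonment rate
  \<open>\<gamma>\<close>.\<close>

lemma z_root_properties:
  fixes lam \<mu> \<gamma> :: real
  assumes "0 < lam" "0 < \<mu>"
  defines "z \<equiv> z_root lam \<mu> \<gamma>"
  shows "0 < z" and "lam * inverse z - \<mu> * z = \<gamma>"
proof -
  have lt: "\<bar>\<gamma>\<bar> < sqrt (\<gamma>\<^sup>2 + 4 * lam * \<mu>)"
    using assms(1,2) by (intro real_less_rsqrt) simp
  then show z: "0 < z"
    using assms(2) unfolding z_def z_root_def by (intro divide_pos_pos) auto
  have "(2 * \<mu> * z + \<gamma>)\<^sup>2 = \<gamma>\<^sup>2 + 4 * lam * \<mu>"
    using assms(1,2) unfolding z_def z_root_def by simp
  then have "4 * \<mu> * (\<mu> * z\<^sup>2 + \<gamma> * z) = 4 * \<mu> * lam"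
    by (simp add: power2_eq_square algebra_simps)
  then have "\<mu> * z\<^sup>2 + \<gamma> * z = lam" using assms(2) by simp
  then show "lam * inverse z - \<mu> * z = \<gamma>"
    using z by (simp add: field_simps power2_eq_square)
qed

text \<open>The difference \<open>\<gamma> - (lam - \<mu>)\<close> factors as
  \<open>(1 - z) * (lam / z + \<mu>)\<close> with positive second factor. This decides the sign of
  \<open>ln z\<close>, and with it which error terms are harmful.\<close>

lemma z_root_le_1_iff:
  assumes "0 < lam" "0 < \<mu>"
  shows "z_root lam \<mu> \<gamma> \<le> 1 \<longleftrightarrow> lam - \<mu> \<le> \<gamma>"
proof -
  define z where "z = z_root lam \<mu> \<gamma>"
  have z: "0 < z" and eq: "lam * inverse z - \<mu> * z = \<gamma>"
    using z_root_properties[OF assms] by (auto simp: z_def)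
  have "\<gamma> - (lam - \<mu>) = (inverse z - 1) * lam + \<mu> * (1 - z)"
    using eq by (simp add: algebra_simps)
  also have "\<dots> = (1 - z) * (lam / z + \<mu>)" using z by (simp add: field_simps)
  finally have *: "\<gamma> - (lam - \<mu>) = (1 - z) * (lam / z + \<mu>)" .
  have "0 < lam / z + \<mu>" using z assms by (simp add: add_pos_pos)
  then have "0 \<le> (1 - z) * (lam / z + \<mu>) \<longleftrightarrow> 0 \<le> 1 - z"
    by (simp add: zero_le_mult_iff)
  then show ?thesis using * unfolding z_def by linarith
qed

text \<open>Substitute \<open>\<gamma> = lam / z - \<mu> * z\<close> in the factor of
  \<open>ln z\<close>. As \<open>ell 1 = 0\<close>, this identifies \<open>C_rate\<close> as the
  running cost of the constant controls \<open>inverse z\<close>, \<open>z\<close>,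
  \<open>1\<close>, and shows that it is nonnegative.\<close>

lemma C_rate_eq_ell:
  assumes "0 < lam" "0 < \<mu>"
  shows "C_rate lam \<mu> \<gamma> = lam * ell (inverse (z_root lam \<mu> \<gamma>)) + \<mu> * ell (z_root lam \<mu> \<gamma>)"
proof -
  define z where "z = z_root lam \<mu> \<gamma>"
  have z: "0 < z" and eq: "lam * inverse z - \<mu> * z = \<gamma>"
    using z_root_properties[OF assms] by (auto simp: z_def)
  have "\<gamma> * ln z = (lam * inverse z - \<mu> * z) * ln z" by (simp add: eq)
  then show ?thesis unfolding C_rate_def ell_def z_def[symmetric]
    using z by (simp add: ln_inverse algebra_simps)
qed

section \<open>Lower bounds for large and for small abandonment\<close>

lemma INF_rate_fun_ge:
  assumes "\<And>\<xi> \<zeta> \<phi>1 \<phi>2 \<phi>3. (\<xi>, \<zeta>) \<in> paths T \<Longrightarrow> Q (\<zeta> T) \<Longrightarrow>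
      (\<phi>1, \<phi>2, \<phi>3) \<in> controls lam \<mu> \<theta> x0 T \<xi> \<zeta> \<Longrightarrow> a \<le> control_cost lam \<mu> \<theta> T \<xi> \<phi>1 \<phi>2 \<phi>3"
  shows "a \<le> (INF (\<xi>, \<zeta>)\<in>{(\<xi>, \<zeta>) \<in> paths T. Q (\<zeta> T)}. rate_fun lam \<mu> \<theta> x0 T \<xi> \<zeta>)"
  using assms unfolding rate_fun_def control_cost_def
  by (intro INF_greatest) (auto split: prod.splits intro!: INF_greatest)

text \<open>For \<open>z \<le> 1\<close> the factor \<open>- ln z\<close> is nonnegative, so the
  bracket in \<open>control_cost_ge\<close> must be bounded below and \<open>- p 0 * L\<close> is
  the dangerous term. The weight \<open>x / (x + e)\<close> removes it, at a loss of at most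
  \<open>\<theta> * e * (inverse z - 1)\<close> per unit of time, because
  \<open>(1 - p x) * x \<le> e\<close>.\<close>

lemma control_cost_ge_abandonment_large:
  assumes pos: "0 < lam" "0 < \<mu>" "0 < \<theta>" "\<mu> \<le> lam" and x0: "0 \<le> x0" and T: "0 < T"
    and z: "0 < z" "z \<le> 1"
    and path: "(\<xi>, \<zeta>) \<in> paths T" and ctl: "(\<phi>1, \<phi>2, \<phi>3) \<in> controls lam \<mu> \<theta> x0 T \<xi> \<zeta>"
    and \<zeta>: "\<gamma> * T \<le> \<zeta> T"
  shows "ennreal ((lam * (1 - inverse z) + \<mu> * (1 - z)) * T - \<theta> * (inverse z - 1) - ln z * (\<gamma> * T - x0))
    \<le> control_cost lam \<mu> \<theta> T \<xi> \<phi>1 \<phi>2 \<phi>3"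
proof -
  \<comment> \<open>On this scale the loss accumulated over \<open>{0..T}\<close> stays
    bounded.\<close>
  define e where "e = 1 / T"
  have e: "0 < e" using T by (simp add: e_def)
  define f where "f = lam * (1 - inverse z) + \<mu> * (1 - z)"
  define m where "m = f - \<theta> * e * (inverse z - 1)"
  define p where "p = (\<lambda>x. x / (x + e))"
  define h where "h = (\<lambda>x. x - e * ln (1 + x / e))"
  have iz: "1 \<le> inverse z" using z by (simp add: one_le_inverse)
  \<comment> \<open>The second factor is nonpositive since
    \<open>\<mu> \<le> lam \<le> lam / z\<close>. Thus \<open>f \<le> 0\<close>, and weighting
    \<open>f\<close> by \<open>p x \<le> 1\<close> can only raise it.\<close>
  have "f = (1 - z) * (\<mu> - lam / z)" using z by (simp add: f_def field_simps)
  moreover have "\<mu> \<le> lam / z" using pos z mult_left_mono[of z 1 lam]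
    by (simp add: field_simps) (smt (verit) mult_right_mono mult_left_le)
  ultimately have f: "f \<le> 0" using z by (simp add: mult_nonneg_nonpos)
  have der: "(h has_real_derivative p x) (at x)" if "0 \<le> x" for x
    unfolding h_def p_def using that e
    by (auto intro!: derivative_eq_intros simp: field_simps add_pos_nonneg)
  have pc: "continuous_on {0..} p" unfolding p_def using e by (intro continuous_intros) auto
  have p: "0 \<le> p x \<and> p x \<le> 1" if "0 \<le> x" for x using that e by (simp add: p_def)
  have m: "m \<le> p x * (lam * (1 - inverse z) + \<mu> * (1 - z)) + (1 - p x) * (\<theta> * x * (1 - inverse z))"
    if x: "0 \<le> x" for x
  proof -
    have "1 * f \<le> p x * f" using f p[OF x] by (intro mult_right_mono_neg) auto
    moreover have "(1 - p x) * x \<le> e" using x e by (simp add: p_def field_simps)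
    then have "(1 - p x) * x * (\<theta> * (inverse z - 1)) \<le> e * (\<theta> * (inverse z - 1))"
      using iz pos by (intro mult_right_mono) auto
    ultimately show ?thesis unfolding m_def f_def[symmetric] by (simp add: algebra_simps)
  qed
  obtain L where "0 \<le> L" and L: "ennreal (m * T - ln z * (h (\<xi> T) - h x0 - p 0 * L + \<zeta> T))
    \<le> control_cost lam \<mu> \<theta> T \<xi> \<phi>1 \<phi>2 \<phi>3"
    using control_cost_ge[OF pos(1-3) x0 _ z(1) path ctl der pc p m] T by auto
  have "0 \<le> \<xi> T" using path T by (simp add: paths_def)
  have h0: "0 \<le> h x" if "0 \<le> x" for x
  proof -
    have "ln (1 + x / e) \<le> x / e" using that e by (intro ln_add_one_self_le_self) auto
    then have "e * ln (1 + x / e) \<le> e * (x / e)" using e by (intro mult_left_mono) auto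
    then show ?thesis using e by (simp add: h_def)
  qed
  have "h x0 \<le> x0" using x0 e by (simp add: h_def)
  then have "\<gamma> * T - x0 \<le> h (\<xi> T) - h x0 - p 0 * L + \<zeta> T"
    using h0[OF \<open>0 \<le> \<xi> T\<close>] \<zeta> by (simp add: p_def)
  then have "- ln z * (\<gamma> * T - x0) \<le> - ln z * (h (\<xi> T) - h x0 - p 0 * L + \<zeta> T)"
    using z by (intro mult_left_mono) auto
  moreover have "m * T = f * T - \<theta> * (inverse z - 1)" using T by (simp add: m_def e_def field_simps)
  ultimately have "f * T - \<theta> * (inverse z - 1) - ln z * (\<gamma> * T - x0)
      \<le> m * T - ln z * (h (\<xi> T) - h x0 - p 0 * L + \<zeta> T)" by simp
  from order_trans[OF ennreal_leI[OF this] L] show ?thesis by (simp add: f_def)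
qed

text \<open>For \<open>z \<ge> 1\<close> the bracket must be bounded above, so
  \<open>- p 0 * L\<close> has a favourable sign and \<open>h (\<xi> T)\<close> is the dangerous
  term. The chosen weight has a primitive bounded by \<open>1 / e\<close>; it departs from
  \<open>1\<close> noticeably only at large \<open>x\<close>, where the third tangent constant
  already exceeds \<open>f\<close>.\<close>

lemma control_cost_ge_abandonment_small:
  assumes pos: "0 < lam" "0 < \<mu>" "0 < \<theta>" and x0: "0 \<le> x0" and T: "0 < T"
    and z: "1 \<le> z"
    and path: "(\<xi>, \<zeta>) \<in> paths T" and ctl: "(\<phi>1, \<phi>2, \<phi>3) \<in> controls lam \<mu> \<theta> x0 T \<xi> \<zeta>"
    and \<zeta>: "\<zeta> T \<le> \<gamma> * T"
  defines "f \<equiv> lam * (1 - inverse z) + \<mu> * (1 - z)"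
  assumes f: "0 \<le> f"
  shows "ennreal (f * T - (2 * f\<^sup>2 / (\<theta> * (1 - inverse z)) + ln z) * sqrt T - ln z * \<gamma> * T)
    \<le> control_cost lam \<mu> \<theta> T \<xi> \<phi>1 \<phi>2 \<phi>3"
proof (cases "z = 1")
  \<comment> \<open>Here \<open>f = 0\<close> and \<open>ln z = 0\<close>, and the quotient
    \<open>0 / 0\<close> is \<open>0\<close>, so the bound is trivial.\<close>
  case True
  then show ?thesis by (simp add: f_def)
next
  case False
  then have z1: "1 < z" using z by simp
  \<comment> \<open>Balances the two errors: the bound \<open>1 / e\<close> for \<open>h\<close>,
    and a loss of order \<open>e * T\<close>.\<close>
  define e where "e = 1 / sqrt T"
  have e: "0 < e" using T by (simp add: e_def)
  have iz: "0 < 1 - inverse z" using z1 by (simp add: inverse_less_1_iff)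
  \<comment> \<open>The queue length at which the third constant
    \<open>\<theta> * x * (1 - inverse z)\<close> reaches \<open>f\<close>.\<close>
  define K where "K = f / (\<theta> * (1 - inverse z))"
  have K: "0 \<le> K" "f = \<theta> * K * (1 - inverse z)" using f pos iz by (auto simp: K_def)
  define m where "m = f - 2 * e * K * f"
  define p where "p = (\<lambda>x. 1 / (1 + e * x)\<^sup>2)"
  define h where "h = (\<lambda>x. x / (1 + e * x))"
  have den: "1 \<le> 1 + e * x" if "0 \<le> x" for x using that e by simp
  have der: "(h has_real_derivative p x) (at x)" if "0 \<le> x" for x
    unfolding h_def p_def using den[OF that]
    by (auto intro!: derivative_eq_intros simp: power2_eq_square algebra_simps)
  have pc: "continuous_on {0..} p" unfolding p_def using den
    by (intro continuous_intros) (smt (verit) atLeast_iff power_not_zero)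
  have p: "0 \<le> p x \<and> p x \<le> 1" if "0 \<le> x" for x
    using den[OF that] by (simp add: p_def)
  have m: "m \<le> p x * (lam * (1 - inverse z) + \<mu> * (1 - z)) + (1 - p x) * (\<theta> * x * (1 - inverse z))"
    if x: "0 \<le> x" for x
  proof -
    have "(1 - p x) * (f - \<theta> * x * (1 - inverse z)) \<le> 2 * e * K * f"
    proof (cases "K \<le> x")
      case True
      then have "\<theta> * K * (1 - inverse z) \<le> \<theta> * x * (1 - inverse z)"
        using pos iz by simp
      then have "(1 - p x) * (f - \<theta> * x * (1 - inverse z)) \<le> 0"
        using K(2) p[OF x] by (intro mult_nonneg_nonpos) auto
      also have "0 \<le> 2 * e * K * f" using e K f by simp
      finally show ?thesis .
    next
      case False
      define d where "d = e * x"
      have d: "0 \<le> d" using e x by (simp add: d_def)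
      \<comment> \<open>The tangent bound \<open>1 - 2 * d \<le> 1 / (1 + d)\<^sup>2\<close> with
        the denominator cleared.\<close>
      have "(1 - 2 * d) * (1 + d)\<^sup>2 = 1 - 3 * d\<^sup>2 - 2 * d ^ 3"
        by (simp add: power2_eq_square power3_eq_cube algebra_simps)
      also have "\<dots> \<le> 1" using d zero_le_power[OF d, of 3] zero_le_power2[of d] by linarith
      finally have "1 - 2 * d \<le> 1 / (1 + d)\<^sup>2" using d
        by (simp add: pos_le_divide_eq)
      then have "1 - p x \<le> 2 * (e * x)" by (simp add: p_def d_def)
      also have "\<dots> \<le> 2 * e * K" using False e by simp
      finally have "1 - p x \<le> 2 * e * K" .
      moreover have "f - \<theta> * x * (1 - inverse z) \<le> f" using pos x iz by simp
      ultimately show ?thesis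
        using f p[OF x] e K mult_mono[of "1 - p x" "2 * e * K" "f" f]
          mult_left_mono[of "f - \<theta> * x * (1 - inverse z)" f "1 - p x"] by simp
    qed
    then show ?thesis unfolding m_def f_def[symmetric] by (simp add: algebra_simps)
  qed
  obtain L where "0 \<le> L" and L: "ennreal (m * T - ln z * (h (\<xi> T) - h x0 - p 0 * L + \<zeta> T))
    \<le> control_cost lam \<mu> \<theta> T \<xi> \<phi>1 \<phi>2 \<phi>3"
    using control_cost_ge[OF pos(1-3) x0 _ _ path ctl der pc p m] T z by auto
  have \<xi>T: "0 \<le> \<xi> T" using path T by (simp add: paths_def)
  have "e * h (\<xi> T) \<le> 1" using den[OF \<xi>T] by (simp add: h_def)
  then have "h (\<xi> T) \<le> sqrt T" using T by (simp add: e_def field_simps)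
  moreover have "0 \<le> h x0" using x0 den[OF x0] by (simp add: h_def)
  moreover have "0 \<le> p 0 * L" using \<open>0 \<le> L\<close> p[of 0] by simp
  ultimately have "h (\<xi> T) - h x0 - p 0 * L + \<zeta> T \<le> sqrt T + \<gamma> * T"
    using \<zeta> by simp
  then have "ln z * (h (\<xi> T) - h x0 - p 0 * L + \<zeta> T) \<le> ln z * (sqrt T + \<gamma> * T)"
    using z by (intro mult_left_mono) auto
  moreover have "e * T = sqrt T" using T by (simp add: e_def real_div_sqrt)
  then have "m * T = f * T - 2 * K * f * sqrt T" by (simp add: m_def algebra_simps)
  moreover have "2 * f\<^sup>2 / (\<theta> * (1 - inverse z)) = 2 * K * f" by (simp add: K_def power2_eq_square)
  ultimately have "f * T - (2 * f\<^sup>2 / (\<theta> * (1 - inverse z)) + ln z) * sqrt T - ln z * \<gamma> * T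
      \<le> m * T - ln z * (h (\<xi> T) - h x0 - p 0 * L + \<zeta> T)" by (simp add: algebra_simps)
  from order_trans[OF ennreal_leI[OF this] L] show ?thesis .
qed


subsection \<open>Upper bound on the cost\<close>

lemma set_integrable_bounded_measurable:
  fixes k :: "real \<Rightarrow> real"
  assumes "k \<in> borel_measurable borel" "\<And>s. s \<in> {a..b} \<Longrightarrow> \<bar>k s\<bar> \<le> B"
  shows "set_integrable lborel {a..b} k"
  unfolding set_integrable_def
proof (rule Bochner_Integration.integrable_bound)
  have "set_integrable lborel {a..b} (\<lambda>s. B)"
    by (intro borel_integrable_atLeastAtMost' continuous_on_const)
  then show "integrable lborel (\<lambda>s. indicator {a..b} s *\<^sub>R B)" by (simp add: set_integrable_def)
  show "(\<lambda>s. indicator {a..b} s *\<^sub>R k s) \<in> borel_measurable lborel"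
    using assms(1) by measurable
  show "AE s in lborel. norm (indicator {a..b} s *\<^sub>R k s) \<le> norm (indicator {a..b} s *\<^sub>R B)"
    using assms(2) by (intro AE_I2) (force simp: indicator_def)
qed

text \<open>The controls constructed below switch at time \<open>1\<close>, where the primitive may
  have a corner; continuity lets the fundamental theorem skip that point.\<close>

lemma set_integral_FTC_except_1:
  fixes k F :: "real \<Rightarrow> real"
  assumes "set_integrable lborel {0..t} k" "0 \<le> t" "continuous_on UNIV F"
    and "\<And>s. s < 1 \<Longrightarrow> (F has_real_derivative k s) (at s)"
    and "\<And>s. 1 < s \<Longrightarrow> (F has_real_derivative k s) (at s)"
  shows "(LINT s:{0..t}|lborel. k s) = F t - F 0"
proof -
  have "(k has_integral (F t - F 0)) {0..t}"
  proof (rule fundamental_theorem_of_calculus_interior_strong[of "{1}"])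
    show "(F has_vector_derivative k s) (at s)" if "s \<in> {0<..<t} - {1}" for s
      using that assms(4,5)[of s] by (cases "s < 1") (auto simp: has_real_derivative_iff_has_vector_derivative)
    show "continuous_on {0..t} F" using assms(3) by (rule continuous_on_subset) simp
  qed (use assms in auto)
  then show ?thesis
    using set_borel_integral_eq_integral(2)[OF assms(1)] by (simp add: integral_unique)
qed

text \<open>The transition during the first unit of time costs an amount independent of
  \<open>T\<close>, absorbed in \<open>K\<close>; thereafter the running cost is exactly
  \<open>C_rate lam \<mu> \<gamma>\<close>. The constraint holds because \<open>\<zeta>\<close>
  gains \<open>\<gamma>\<close> in the first unit and then grows at rate
  \<open>\<theta> * y = \<gamma>\<close>.\<close>

lemma I_eq_upper_bound:
  assumes pos: "0 < lam" "0 < \<mu>" "0 < \<theta>" and x0: "0 \<le> x0" and \<gamma>: "0 \<le> \<gamma>"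
  shows "\<exists>K\<ge>0. \<forall>T\<ge>1. I_eq lam \<mu> \<theta> x0 \<gamma> T \<le> ennreal (K + C_rate lam \<mu> \<gamma> * T)"
proof -
  define z where "z = z_root lam \<mu> \<gamma>"
  have z: "0 < z" and zeq: "lam * inverse z - \<mu> * z = \<gamma>"
    using z_root_properties[OF pos(1,2)] by (auto simp: z_def)
  have Ceq: "C_rate lam \<mu> \<gamma> = lam * ell (inverse z) + \<mu> * ell z"
    using C_rate_eq_ell[OF pos(1,2)] by (simp add: z_def)
  define y where "y = \<gamma> / \<theta>"
  have y: "0 \<le> y" "\<theta> * y = \<gamma>" using \<gamma> pos by (auto simp: y_def)
  \<comment> \<open>Chosen so that \<open>\<zeta>(1) = \<gamma>\<close>; for \<open>\<gamma> = x0 = 0\<close> this is \<open>0 / 0 = 0\<close>.\<close>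
  define c where "c = 2 * \<gamma> / (\<theta> * (x0 + y))"
  have c: "0 \<le> c" using \<gamma> pos x0 y by (simp add: c_def)
  have c\<gamma>: "\<theta> * c * (x0 + y) / 2 = \<gamma>"
  proof (cases "\<gamma> = 0")
    case False
    then have "0 < x0 + y" using \<gamma> pos x0 by (simp add: y_def add_nonneg_pos)
    then show ?thesis using pos by (simp add: c_def)
  qed (simp add: c_def)
  define \<xi> where "\<xi> = (\<lambda>t::real. x0 + (y - x0) * min t 1)"
  \<comment> \<open>Before time \<open>1\<close> arrivals replace all abandonment, and the slope
    \<open>y - x0\<close> is split into positive and negative parts to keep both controls
    nonnegative. Afterwards the drift \<open>lam / z - \<mu> * z - \<theta> * y\<close>
    vanishes.\<close>
  define \<phi>1 where "\<phi>1 = (\<lambda>s. if s < 1 then (\<theta> * (c * \<xi> s) + max (y - x0) 0) / lam else inverse z)"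
  define \<phi>2 where "\<phi>2 = (\<lambda>s::real. if s < 1 then max (x0 - y) 0 / \<mu> else z)"
  define \<phi>3 where "\<phi>3 = (\<lambda>s::real. if s < 1 then c else 1)"
  define \<zeta> where "\<zeta> = (\<lambda>t. \<theta> * (LINT s:{0..t}|lborel. \<phi>3 s * \<xi> s))"
  have \<xi>b: "0 \<le> \<xi> s \<and> \<xi> s \<le> x0 + y" if "0 \<le> s" for s
  proof -
    define r where "r = min s 1"
    have r: "0 \<le> r" "r \<le> 1" using that by (auto simp: r_def)
    have "\<xi> s = x0 * (1 - r) + y * r" by (simp add: \<xi>_def r_def algebra_simps)
    moreover have "x0 * (1 - r) \<le> x0 * 1" "y * r \<le> y * 1" using x0 y r by (intro mult_left_mono; simp)+
    ultimately show ?thesis using r x0 y by simp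
  qed
  have \<xi>c: "continuous_on A \<xi>" for A unfolding \<xi>_def by (intro continuous_intros)
  have m\<xi> [measurable]: "\<xi> \<in> borel_measurable borel"
    by (rule borel_measurable_continuous_onI[OF \<xi>c])
  have m [measurable]: "\<phi>1 \<in> borel_measurable borel" "\<phi>2 \<in> borel_measurable borel"
    "\<phi>3 \<in> borel_measurable borel"
    unfolding \<phi>1_def \<phi>2_def \<phi>3_def by measurable
  define B where "B = (\<theta> * (c * (x0 + y)) + max (y - x0) 0) / lam + inverse z
      + max (x0 - y) 0 / \<mu> + z + c + 1"
  have parts: "0 \<le> (\<theta> * (c * (x0 + y)) + max (y - x0) 0) / lam" "0 \<le> inverse z"
    "0 \<le> max (x0 - y) 0 / \<mu>" using pos c x0 y z by auto
  have b: "0 \<le> \<phi>1 s \<and> \<phi>1 s \<le> B" "0 \<le> \<phi>2 s \<and> \<phi>2 s \<le> B" "0 \<le> \<phi>3 s \<and> \<phi>3 s \<le> B" if "0 \<le> s" for s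
  proof -
    have "(\<theta> * (c * \<xi> s) + max (y - x0) 0) / lam \<le> (\<theta> * (c * (x0 + y)) + max (y - x0) 0) / lam"
      using \<xi>b[OF that] pos c by (intro divide_right_mono add_right_mono mult_left_mono) auto
    moreover have "0 \<le> (\<theta> * (c * \<xi> s) + max (y - x0) 0) / lam"
      using \<xi>b[OF that] pos c by simp
    ultimately show "0 \<le> \<phi>1 s \<and> \<phi>1 s \<le> B" "0 \<le> \<phi>2 s \<and> \<phi>2 s \<le> B" "0 \<le> \<phi>3 s \<and> \<phi>3 s \<le> B"
      using parts c z unfolding \<phi>1_def \<phi>2_def \<phi>3_def B_def
      by (cases "s < 1"; simp only: if_True if_False; linarith)+
  qed
  have B: "0 \<le> B" using b(1)[of 0] by simp
  have i1: "set_integrable lborel {0..t} \<phi>1" and i2: "set_integrable lborel {0..t} \<phi>2"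
    and i3: "set_integrable lborel {0..t} (\<lambda>s. \<phi>3 s * \<xi> s)" for t
  proof -
    have bb: "\<bar>\<phi>1 s\<bar> \<le> B" "\<bar>\<phi>2 s\<bar> \<le> B" if "s \<in> {0..t}" for s using b(1,2)[of s] that by auto
    show "set_integrable lborel {0..t} \<phi>1"
      by (rule set_integrable_bounded_measurable[OF m(1) bb(1)])
    show "set_integrable lborel {0..t} \<phi>2"
      by (rule set_integrable_bounded_measurable[OF m(2) bb(2)])
    have "\<bar>\<phi>3 s * \<xi> s\<bar> \<le> B * (x0 + y)" if "s \<in> {0..t}" for s
      using b(3)[of s] \<xi>b[of s] that B by (auto simp: abs_mult intro!: mult_mono)
    then show "set_integrable lborel {0..t} (\<lambda>s. \<phi>3 s * \<xi> s)"
      by (intro set_integrable_bounded_measurable) measurable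
  qed
  have \<psi>: "x0 + lam * (LINT s:{0..u}|lborel. \<phi>1 s) - \<mu> * (LINT s:{0..u}|lborel. \<phi>2 s)
      - \<theta> * (LINT s:{0..u}|lborel. \<phi>3 s * \<xi> s) = \<xi> u" if u: "0 \<le> u" for u
  proof -
    define g where "g = (\<lambda>s. lam * \<phi>1 s - \<mu> * \<phi>2 s - \<theta> * (\<phi>3 s * \<xi> s))"
    have gi: "set_integrable lborel {0..u} g"
      unfolding g_def using i1 i2 i3 by (intro set_integral_diff(1) set_integrable_mult_right) auto
    have "(LINT s:{0..u}|lborel. g s) = \<xi> u - \<xi> 0"
    proof (rule set_integral_FTC_except_1[OF gi u \<xi>c])
      fix s :: real assume s: "s < 1"
      have "g s = y - x0" using s pos by (simp add: g_def \<phi>1_def \<phi>2_def \<phi>3_def max_def)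
      moreover have "((\<lambda>t. x0 + (y - x0) * t) has_real_derivative (y - x0)) (at s)"
        by (auto intro!: derivative_eq_intros)
      ultimately have "((\<lambda>t. x0 + (y - x0) * t) has_real_derivative g s) (at s)" by simp
      then show "(\<xi> has_real_derivative g s) (at s)"
        by (rule has_field_derivative_transform_within_open[where S="{..<1}"])
           (use s in \<open>auto simp: \<xi>_def\<close>)
    next
      fix s :: real assume s: "1 < s"
      have "g s = 0" using s zeq y by (simp add: g_def \<phi>1_def \<phi>2_def \<phi>3_def \<xi>_def)
      then have "((\<lambda>t. y) has_real_derivative g s) (at s)" by simp
      then show "(\<xi> has_real_derivative g s) (at s)"
        by (rule has_field_derivative_transform_within_open[where S="{1<..}"])
           (use s in \<open>auto simp: \<xi>_def\<close>)
    qed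
    moreover have "(LINT s:{0..u}|lborel. g s) = lam * (LINT s:{0..u}|lborel. \<phi>1 s)
      - \<mu> * (LINT s:{0..u}|lborel. \<phi>2 s) - \<theta> * (LINT s:{0..u}|lborel. \<phi>3 s * \<xi> s)"
      unfolding g_def using i1 i2 i3 by (simp add: set_integral_diff)
    moreover have "\<xi> 0 = x0" by (simp add: \<xi>_def)
    ultimately show ?thesis by simp
  qed
  have \<zeta>T: "\<zeta> T = \<gamma> * T" if T: "1 \<le> T" for T
  proof -
    \<comment> \<open>Quadratic while \<open>\<xi>\<close> is moving, then linear with slope
      \<open>y\<close>; \<open>min\<close> and \<open>max\<close> join the pieces
      continuously.\<close>
    define F where "F = (\<lambda>t::real. c * (x0 * min t 1 + (y - x0) * (min t 1)\<^sup>2 / 2) + y * max (t - 1) 0)"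
    have "(LINT s:{0..T}|lborel. \<phi>3 s * \<xi> s) = F T - F 0"
    proof (rule set_integral_FTC_except_1[OF i3])
      show "continuous_on UNIV F" unfolding F_def by (intro continuous_intros) auto
      fix s :: real assume s: "s < 1"
      have "((\<lambda>t. c * (x0 * t + (y - x0) * t\<^sup>2 / 2)) has_real_derivative (\<phi>3 s * \<xi> s)) (at s)"
        using s by (auto intro!: derivative_eq_intros simp: \<phi>3_def \<xi>_def)
      then show "(F has_real_derivative \<phi>3 s * \<xi> s) (at s)"
        by (rule has_field_derivative_transform_within_open[where S="{..<1}"])
           (use s in \<open>auto simp: F_def\<close>)
    next
      fix s :: real assume s: "1 < s"
      have "((\<lambda>t. c * (x0 + (y - x0) / 2) + y * (t - 1)) has_real_derivative (\<phi>3 s * \<xi> s)) (at s)"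
        using s by (auto intro!: derivative_eq_intros simp: \<phi>3_def \<xi>_def)
      then show "(F has_real_derivative \<phi>3 s * \<xi> s) (at s)"
        by (rule has_field_derivative_transform_within_open[where S="{1<..}"])
           (use s in \<open>auto simp: F_def\<close>)
    qed (use T in auto)
    also have "F T - F 0 = c * (x0 + y) / 2 + y * (T - 1)"
      using T by (simp add: F_def field_simps)
    finally have "\<zeta> T = \<theta> * c * (x0 + y) / 2 + \<theta> * y * (T - 1)"
      by (simp add: \<zeta>_def distrib_left)
    then show ?thesis unfolding c\<gamma> y(2) by (simp add: algebra_simps)
  qed
  \<comment> \<open>Comes from \<open>ell x \<le> (x - 1)\<^sup>2 \<le> B\<^sup>2 + 1\<close> for
    \<open>0 \<le> x \<le> B\<close>.\<close>
  define K where "K = lam * (B\<^sup>2 + 1) + \<mu> * (B\<^sup>2 + 1) + \<theta> * ((x0 + y) * (B\<^sup>2 + 1))"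
  have K: "0 \<le> K" using pos x0 y by (simp add: K_def)
  have C0: "0 \<le> C_rate lam \<mu> \<gamma>" using pos z by (simp add: Ceq ell_nonneg)
  have "I_eq lam \<mu> \<theta> x0 \<gamma> T \<le> ennreal (K + C_rate lam \<mu> \<gamma> * T)" if T: "1 \<le> T" for T
  proof -
    have path: "(\<xi>, \<zeta>) \<in> paths T"
    proof -
      have "continuous_on {0..T} \<zeta>"
        unfolding \<zeta>_def by (intro continuous_intros continuous_on_set_integral i3)
      moreover have "0 \<le> \<zeta> t" for t
        unfolding \<zeta>_def set_lebesgue_integral_def using pos b(3) \<xi>b
        by (intro mult_nonneg_nonneg integral_nonneg_AE AE_I2) (auto simp: indicator_def)
      ultimately show ?thesis using \<xi>c \<xi>b by (auto simp: paths_def)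
    qed
    have sk: "skorohod (\<lambda>u. x0 + lam * (LINT s:{0..u}|lborel. \<phi>1 s) - \<mu> * (LINT s:{0..u}|lborel. \<phi>2 s)
      - \<theta> * (LINT s:{0..u}|lborel. \<phi>3 s * \<xi> s)) t = \<xi> t" if "0 \<le> t" for t
      using \<psi> \<xi>b that by (subst skorohod_nonneg_path) auto
    have mr: "\<phi>1 \<in> borel_measurable (restrict_space borel {0..T})"
      "\<phi>2 \<in> borel_measurable (restrict_space borel {0..T})"
      "\<phi>3 \<in> borel_measurable (restrict_space borel {0..T})"
      using m by (auto intro: measurable_restrict_space1)
    have ctl: "(\<phi>1, \<phi>2, \<phi>3) \<in> controls lam \<mu> \<theta> x0 T \<xi> \<zeta>"
      using mr b i1 i2 i3 sk by (auto simp: controls_def \<zeta>_def)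
    have "I_eq lam \<mu> \<theta> x0 \<gamma> T \<le> rate_fun lam \<mu> \<theta> x0 T \<xi> \<zeta>"
      unfolding I_eq_def using path \<zeta>T[OF T] by (intro INF_lower2[of "(\<xi>, \<zeta>)"]) auto
    also have "\<dots> \<le> control_cost lam \<mu> \<theta> T \<xi> \<phi>1 \<phi>2 \<phi>3"
      unfolding rate_fun_def control_cost_def using ctl
      by (intro INF_lower2[of "(\<phi>1, \<phi>2, \<phi>3)"]) auto
    also have "\<dots> = (\<integral>\<^sup>+ s. ennreal (lam * ell (\<phi>1 s) + \<mu> * ell (\<phi>2 s) + \<theta> * (\<xi> s * ell (\<phi>3 s)))
        * indicator {0..T} s \<partial>lborel)"
      using b \<xi>b by (subst control_cost_eq[OF pos mr _ \<xi>c]) (auto simp: nn_integral_restrict_space)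
    also have "\<dots> \<le> (\<integral>\<^sup>+ s. ennreal K * indicator {0..1} s
        + ennreal (C_rate lam \<mu> \<gamma>) * indicator {0..T} s \<partial>lborel)"
    proof (intro nn_integral_mono)
      fix s :: real
      let ?k = "lam * ell (\<phi>1 s) + \<mu> * ell (\<phi>2 s) + \<theta> * (\<xi> s * ell (\<phi>3 s))"
      show "ennreal ?k * indicator {0..T} s
        \<le> ennreal K * indicator {0..1} s + ennreal (C_rate lam \<mu> \<gamma>) * indicator {0..T} s"
      proof (cases "s \<in> {0..T}")
        case True
        then have s: "0 \<le> s" "s \<le> T" by auto
        have eb: "ell x \<le> B\<^sup>2 + 1" if "0 \<le> x \<and> x \<le> B" for x
        proof -
          have "x\<^sup>2 \<le> B\<^sup>2" using that by (intro power_mono) auto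
          then show ?thesis using ell_le_square[of x] that by (simp add: power2_eq_square algebra_simps)
        qed
        show ?thesis
        proof (cases "s \<le> 1")
          \<comment> \<open>At \<open>s = 1\<close> the controls have already switched, but
            \<open>B\<close>, and hence \<open>K\<close>, covers both phases.\<close>
          case le: True
          have "?k \<le> K" unfolding K_def
            using pos s \<xi>b[OF s(1)] x0 y b[OF s(1)]
            by (intro add_mono mult_left_mono mult_mono eb ell_nonneg) auto
          also have "K \<le> K + C_rate lam \<mu> \<gamma>" using C0 by simp
          finally have "ennreal ?k \<le> ennreal (K + C_rate lam \<mu> \<gamma>)" by (rule ennreal_leI)
          then show ?thesis using s le K C0 by (simp add: ennreal_plus)
        next
          case False
          then have "?k = C_rate lam \<mu> \<gamma>" by (simp add: \<phi>1_def \<phi>2_def \<phi>3_def Ceq ell_def[of 1])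
          then show ?thesis using s False by simp
        qed
      qed simp
    qed
    also have "\<dots> = ennreal K + ennreal (C_rate lam \<mu> \<gamma>) * ennreal T"
      using T by (simp add: nn_integral_add nn_integral_cmult)
    also have "\<dots> = ennreal (K + C_rate lam \<mu> \<gamma> * T)"
      using K C0 T by (simp add: ennreal_mult ennreal_plus)
    finally show ?thesis .
  qed
  with K show ?thesis by blast
qed

section \<open>Passage to the limit\<close>

text \<open>A sandwich in \<open>ereal\<close>. A negative \<open>a T\<close> becomes
  \<open>0\<close> under \<open>ennreal\<close>, which lies above it, so the lower bound survives
  the conversion.\<close>

lemma tendsto_enn2ereal_divide_squeeze:
  assumes lo: "\<And>T. 1 \<le> T \<Longrightarrow> ennreal (a T) \<le> I T" and up: "\<And>T. 1 \<le> T \<Longrightarrow> I T \<le> ennreal (b T)"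
    and b0: "\<And>T. 1 \<le> T \<Longrightarrow> 0 \<le> b T"
    and la: "((\<lambda>T. a T / T) \<longlongrightarrow> C) at_top" and lb: "((\<lambda>T. b T / T) \<longlongrightarrow> C) at_top"
  shows "((\<lambda>T. enn2ereal (I T) / ereal T) \<longlongrightarrow> ereal C) at_top"
proof (rule tendsto_sandwich[of "\<lambda>T. ereal (a T / T)" _ _ "\<lambda>T. ereal (b T / T)"])
  have E: "\<forall>\<^sub>F T in at_top. (1::real) \<le> T" by (rule eventually_ge_at_top)
  show "\<forall>\<^sub>F T in at_top. ereal (a T / T) \<le> enn2ereal (I T) / ereal T"
    using E
  proof eventually_elim
    case (elim T)
    have "ereal (a T) \<le> enn2ereal (ennreal (a T))"
      by (cases "0 \<le> a T") (auto simp: enn2ereal_ennreal ennreal_neg zero_ennreal.rep_eq)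
    also have "\<dots> \<le> enn2ereal (I T)" using lo[OF elim] by (simp add: less_eq_ennreal.rep_eq)
    finally show ?case using elim ereal_divide_right_mono[of "ereal (a T)" "enn2ereal (I T)" "ereal T"]
      by simp
  qed
  show "\<forall>\<^sub>F T in at_top. enn2ereal (I T) / ereal T \<le> ereal (b T / T)"
    using E
  proof eventually_elim
    case (elim T)
    have "enn2ereal (I T) \<le> ereal (b T)"
      using up[OF elim] b0[OF elim] by (simp add: less_eq_ennreal.rep_eq enn2ereal_ennreal)
    then show ?case using elim ereal_divide_right_mono[of "enn2ereal (I T)" "ereal (b T)" "ereal T"]
      by simp
  qed
qed (use la lb in \<open>simp_all add: tendsto_ereal\<close>)

theorem theorem2p3:
  fixes lam \<mu> \<theta> x0 :: real
  assumes "lam > 0" and "\<mu> > 0" and "\<theta> > 0" and "lam \<ge> \<mu>" and "x0 \<ge> 0"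
  shows "(\<forall>\<gamma>\<ge>0.
            ((\<lambda>T. enn2ereal (I_eq lam \<mu> \<theta> x0 \<gamma> T) / ereal T) \<longlongrightarrow> ereal (C_rate lam \<mu> \<gamma>)) at_top)
       \<and> (\<forall>\<gamma>\<ge>lam - \<mu>.
            ((\<lambda>T. enn2ereal (I_ge lam \<mu> \<theta> x0 \<gamma> T) / ereal T) \<longlongrightarrow> ereal (C_rate lam \<mu> \<gamma>)) at_top)
       \<and> (\<forall>\<gamma>. 0 \<le> \<gamma> \<and> \<gamma> \<le> lam - \<mu> \<longrightarrow>
            ((\<lambda>T. enn2ereal (I_le lam \<mu> \<theta> x0 \<gamma> T) / ereal T) \<longlongrightarrow> ereal (C_rate lam \<mu> \<gamma>)) at_top)"
proof -
  note pos = assms(1-3)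
  \<comment> \<open>\<open>I\<close> may be anything below \<open>I_eq\<close>: relaxing the
    constraint lowers the infimum, so one construction serves all three quantities.\<close>
  have upper: "\<exists>K\<ge>0. \<forall>T\<ge>1. I T \<le> ennreal (K + C_rate lam \<mu> \<gamma> * T)"
    if "0 \<le> \<gamma>" and "\<And>T. I T \<le> I_eq lam \<mu> \<theta> x0 \<gamma> T" for \<gamma> I
    using I_eq_upper_bound[OF pos assms(5) that(1)] that(2) order_trans by blast
  have squeeze: "((\<lambda>T. enn2ereal (I T) / ereal T) \<longlongrightarrow> ereal (C_rate lam \<mu> \<gamma>)) at_top"
    if \<gamma>: "0 \<le> \<gamma>" and I: "\<And>T. I T \<le> I_eq lam \<mu> \<theta> x0 \<gamma> T"
      and lo: "\<And>T. 1 \<le> T \<Longrightarrow> ennreal (a T) \<le> I T"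
      and la: "((\<lambda>T. a T / T) \<longlongrightarrow> C_rate lam \<mu> \<gamma>) at_top" for \<gamma> I a
  proof -
    obtain K where K: "0 \<le> K" "\<And>T. 1 \<le> T \<Longrightarrow> I T \<le> ennreal (K + C_rate lam \<mu> \<gamma> * T)"
      using upper[OF \<gamma> I] by blast
    have C0: "0 \<le> C_rate lam \<mu> \<gamma>"
      using C_rate_eq_ell[OF pos(1,2)] z_root_properties(1)[OF pos(1,2)] pos
      by (simp add: ell_nonneg less_imp_le)
    show ?thesis
    proof (rule tendsto_enn2ereal_divide_squeeze[OF lo K(2) _ la])
      show "((\<lambda>T. (K + C_rate lam \<mu> \<gamma> * T) / T) \<longlongrightarrow> C_rate lam \<mu> \<gamma>) at_top" by real_asymp
    qed (use K C0 in auto)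
  qed
  \<comment> \<open>Stated for any \<open>I\<close> between \<open>I_ge\<close> and
    \<open>I_eq\<close>, which settles the equality and the inequality problem together;
    \<open>le\<close> below does the same.\<close>
  have ge: "((\<lambda>T. enn2ereal (I T) / ereal T) \<longlongrightarrow> ereal (C_rate lam \<mu> \<gamma>)) at_top"
    if \<gamma>: "lam - \<mu> \<le> \<gamma>" and I: "\<And>T. I T \<le> I_eq lam \<mu> \<theta> x0 \<gamma> T"
      and I': "\<And>T. I_ge lam \<mu> \<theta> x0 \<gamma> T \<le> I T" for \<gamma> I
  proof -
    define z where "z = z_root lam \<mu> \<gamma>"
    have z: "0 < z" "z \<le> 1"
      using z_root_properties(1)[OF pos(1,2)] z_root_le_1_iff[OF pos(1,2)] \<gamma> by (auto simp: z_def)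
    define f where "f = lam * (1 - inverse z) + \<mu> * (1 - z)"
    have C: "C_rate lam \<mu> \<gamma> = f - \<gamma> * ln z" by (simp add: C_rate_def f_def z_def)
    show ?thesis
    proof (rule squeeze[OF _ I])
      fix T :: real assume T: "1 \<le> T"
      have "ennreal (f * T - \<theta> * (inverse z - 1) - ln z * (\<gamma> * T - x0)) \<le> I_ge lam \<mu> \<theta> x0 \<gamma> T"
        unfolding I_ge_def f_def
        by (rule INF_rate_fun_ge, rule control_cost_ge_abandonment_large[OF pos assms(4,5) _ z])
           (use T in auto)
      with I' show "ennreal (f * T - \<theta> * (inverse z - 1) - ln z * (\<gamma> * T - x0)) \<le> I T"
        using order_trans by blast
    next
      show "((\<lambda>T. (f * T - \<theta> * (inverse z - 1) - ln z * (\<gamma> * T - x0)) / T) \<longlongrightarrow> C_rate lam \<mu> \<gamma>) at_top"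
        unfolding C by (real_asymp simp: algebra_simps)
    qed (use \<gamma> assms in auto)
  qed
  have le: "((\<lambda>T. enn2ereal (I T) / ereal T) \<longlongrightarrow> ereal (C_rate lam \<mu> \<gamma>)) at_top"
    if \<gamma>: "0 \<le> \<gamma>" "\<gamma> \<le> lam - \<mu>" and I: "\<And>T. I T \<le> I_eq lam \<mu> \<theta> x0 \<gamma> T"
      and I': "\<And>T. I_le lam \<mu> \<theta> x0 \<gamma> T \<le> I T" for \<gamma> I
  proof -
    define z where "z = z_root lam \<mu> \<gamma>"
    have z0: "0 < z" and eq: "lam * inverse z - \<mu> * z = \<gamma>"
      using z_root_properties[OF pos(1,2)] by (auto simp: z_def)
    have z: "1 \<le> z"
    proof (cases "\<gamma> = lam - \<mu>")
      \<comment> \<open>At the boundary value the equivalence yields only \<open>z \<le> 1\<close>,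
        so the root is computed: it is \<open>1\<close>.\<close>
      case True
      have "sqrt (\<gamma>\<^sup>2 + 4 * lam * \<mu>) = lam + \<mu>"
        using pos by (intro real_sqrt_unique) (auto simp: True power2_eq_square algebra_simps)
      then show ?thesis using pos by (simp add: z_def z_root_def True)
    qed (use z_root_le_1_iff[OF pos(1,2), of \<gamma>] \<gamma> in \<open>auto simp: z_def\<close>)
    define f where "f = lam * (1 - inverse z) + \<mu> * (1 - z)"
    have C: "C_rate lam \<mu> \<gamma> = f - \<gamma> * ln z" by (simp add: C_rate_def f_def z_def)
    \<comment> \<open>The second factor is nonnegative since
      \<open>lam / z = \<gamma> + \<mu> * z \<ge> \<mu>\<close>.\<close>
    have "f = (z - 1) * (lam * inverse z - \<mu>)" using z by (simp add: f_def field_simps)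
    moreover have "\<mu> * 1 \<le> \<mu> * z" using pos z by (intro mult_left_mono) auto
    ultimately have f: "0 \<le> f" using z eq \<gamma> by simp
    define D where "D = 2 * f\<^sup>2 / (\<theta> * (1 - inverse z)) + ln z"
    show ?thesis
    proof (rule squeeze[OF \<gamma>(1) I])
      fix T :: real assume T: "1 \<le> T"
      have "ennreal (f * T - D * sqrt T - ln z * \<gamma> * T) \<le> I_le lam \<mu> \<theta> x0 \<gamma> T"
        unfolding I_le_def f_def D_def
        by (rule INF_rate_fun_ge, rule control_cost_ge_abandonment_small[OF pos assms(5) _ z])
           (use T f f_def in auto)
      with I' show "ennreal (f * T - D * sqrt T - ln z * \<gamma> * T) \<le> I T"
        using order_trans by blast
    next
      show "((\<lambda>T. (f * T - D * sqrt T - ln z * \<gamma> * T) / T) \<longlongrightarrow> C_rate lam \<mu> \<gamma>) at_top"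
        unfolding C by (real_asymp simp: algebra_simps)
    qed
  qed
  have I1: "I_ge lam \<mu> \<theta> x0 \<gamma> T \<le> I_eq lam \<mu> \<theta> x0 \<gamma> T"
    and I2: "I_le lam \<mu> \<theta> x0 \<gamma> T \<le> I_eq lam \<mu> \<theta> x0 \<gamma> T" for \<gamma> T
    unfolding I_ge_def I_eq_def I_le_def by (intro INF_superset_mono; auto)+
  show ?thesis
  proof (intro conjI allI impI)
    \<comment> \<open>Every \<open>\<gamma> \<ge> 0\<close> lies in one of the two ranges, which
      meet at \<open>lam - \<mu>\<close>.\<close>
    show "((\<lambda>T. enn2ereal (I_eq lam \<mu> \<theta> x0 \<gamma> T) / ereal T) \<longlongrightarrow> ereal (C_rate lam \<mu> \<gamma>)) at_top"
      if "0 \<le> \<gamma>" for \<gamma>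
      using ge[OF _ order_refl I1, of \<gamma>] le[OF that _ order_refl I2] by linarith
    show "((\<lambda>T. enn2ereal (I_ge lam \<mu> \<theta> x0 \<gamma> T) / ereal T) \<longlongrightarrow> ereal (C_rate lam \<mu> \<gamma>)) at_top"
      if "lam - \<mu> \<le> \<gamma>" for \<gamma>
      by (rule ge[OF that I1 order_refl])
    show "((\<lambda>T. enn2ereal (I_le lam \<mu> \<theta> x0 \<gamma> T) / ereal T) \<longlongrightarrow> ereal (C_rate lam \<mu> \<gamma>)) at_top"
      if "0 \<le> \<gamma> \<and> \<gamma> \<le> lam - \<mu>" for \<gamma>
      using that by (intro le[OF _ _ I2 order_refl]) auto
  qed
qed

end
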